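(* Let $K:\mathbb{R}^2\to\mathbb{R}$ be a smooth function satisfying the polynomially cone condition $\mathbf{(PCC)}$ (with $n=2$) and $x\cdot\nabla K(x)\le 0$ for all $x\in\mathbb{R}^2$. Then there is no function $u\in C^\infty(\mathbb{R}^2)$ satisfying $$-\Delta u=K(x)e^{2u}\quad\text{on }\mathbb{R}^2,$$ with $u\le C$ on $\mathbb{R}^2$ for some constant $C\in\mathbb{R}$, and such that $$\int_{\mathbb{R}^2}|K(x)|e^{2u(x)}\,\mathrm{d}x<\infty.$$
   Context: Polynomially cone condition $\mathbf{(PCC)}$: a continuous function $K:\mathbb{R}^n\to\mathbb{R}$ satisfies $\mathbf{(PCC)}$ if there exist $R_1>0$, $\theta>0$, $\gamma\ge n$, $c_1>0$, $c_2>0$ and a cone $C_\theta$ with angle $\theta$ and vertex at the origin (i.e. a solid circular cone $C_\theta=\{x\in\mathbb{R}^n: x\cdot e\ge |x|\cos\theta\}$ for some unit vector $e$ and $0<\theta\le\pi$) such that $|K(x)|\le c_2|x|^\gamma$ for all $|x|\ge R_1$, and $|K(x)|\ge c_1|x|^\gamma$ for all $x\in C_\theta\setminus B_{R_1}(0)$. Here $B_r(x_0)$ is the Euclidean ball of radius $r$ centered at $x_0$. $\Delta$ is the Euclidean Laplacian and $u$ is real-valued. *)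

theory Defs
  imports "HOL-Analysis.Analysis"
begin

text \<open>
  \<open>C_k k f\<close>: \<open>f\<close> is \<open>k\<close> times continuously (Frechet) differentiable on the whole space.
  It suffices to recurse on the directional derivatives \<open>x \<mapsto> Df(x) v\<close>,
  since the domain is finite-dimensional.
\<close>

primrec C_k :: "nat \<Rightarrow> ('a::euclidean_space \<Rightarrow> real) \<Rightarrow> bool" where
  "C_k 0 f \<longleftrightarrow> continuous_on UNIV f"
| "C_k (Suc k) f \<longleftrightarrow> (\<forall>x. f differentiable (at x)) \<and>
     (\<forall>v. C_k k (\<lambda>x. frechet_derivative f (at x) v))"

definition C_infinity :: "('a::euclidean_space \<Rightarrow> real) \<Rightarrow> bool" where
  "C_infinity f \<longleftrightarrow> (\<forall>k. C_k k f)"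

definition gradient :: "('a::euclidean_space \<Rightarrow> real) \<Rightarrow> 'a \<Rightarrow> 'a" where
  "gradient f x = (\<Sum>b\<in>Basis. frechet_derivative f (at x) b *\<^sub>R b)"

definition laplacian :: "('a::euclidean_space \<Rightarrow> real) \<Rightarrow> 'a \<Rightarrow> real" where
  "laplacian f x =
     (\<Sum>b\<in>Basis. frechet_derivative (\<lambda>y. frechet_derivative f (at y) b) (at x) b)"

text \<open>
  The solid circular cone with vertex at the origin, axis \<open>e\<close> (a unit vector)
  and half-opening angle \<open>\<theta>\<close>.
\<close>

definition circular_cone :: "'a::euclidean_space \<Rightarrow> real \<Rightarrow> 'a set" where
  "circular_cone e \<theta> = {x. x \<bullet> e \<ge> norm x * cos \<theta>}"

text \<open>
  The polynomially cone condition. The ball that is removed is open, so that both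
  estimates concern points with \<open>norm x \<ge> R1\<close>.
\<close>

definition PCC :: "('a::euclidean_space \<Rightarrow> real) \<Rightarrow> bool" where
  "PCC K \<longleftrightarrow> continuous_on UNIV K \<and>
     (\<exists>R1 \<theta> \<gamma> c1 c2 :: real. \<exists>e :: 'a.
        R1 > 0 \<and> 0 < \<theta> \<and> \<theta> \<le> pi \<and> \<gamma> \<ge> real DIM('a) \<and> c1 > 0 \<and> c2 > 0 \<and> norm e = 1 \<and>
        (\<forall>x. norm x \<ge> R1 \<longrightarrow> \<bar>K x\<bar> \<le> c2 * norm x powr \<gamma>) \<and>
        (\<forall>x \<in> circular_cone e \<theta> - ball 0 R1. \<bar>K x\<bar> \<ge> c1 * norm x powr \<gamma>))"

end

theory Submission
  imports Defs
begin

text \<open>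
  In logarithmic polar coordinates \<open>w(t, p) = u (e\<^sup>t cos p, e\<^sup>t sin p)\<close> the equation becomes
  \<open>w\<^sub>t\<^sub>t + w\<^sub>p\<^sub>p = - F\<close> on a cylinder, with \<open>F = K e\<^bsup>2t + 2w\<^esup>\<close> integrable. The Pohozaev energy
  \<open>E(t) = \<integral> (w\<^sub>t + 1)\<^sup>2 - w\<^sub>p\<^sup>2 + F dp\<close> starts at \<open>2\<pi>\<close> for \<open>t \<rightarrow> - \<infinity>\<close> and is nonincreasing because
  \<open>x \<bullet> \<nabla>K \<le> 0\<close>; it drops strictly below \<open>2\<pi>\<close> since \<open>K\<close> is not constant along the rays in the cone.

  As \<open>u\<close> is bounded above and the circle averages of \<open>w\<close> grow at most linearly, the oscillation of \<open>w\<close>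
  on the circle has linearly growing \<open>L\<^sup>1\<close> norm; interpolating with the Dirichlet energy in a
  convexity inequality for its \<open>L\<^sup>2\<close> norm shows that \<open>\<integral> w\<^sub>p\<^sup>2 dp\<close> and \<open>\<integral> |F| dp\<close> are simultaneously small
  at arbitrarily late times. At such times smallness of \<open>\<integral> |F| dp\<close> over the cone forces the circle
  average of \<open>w\<close> below \<open>- 2t + O(1)\<close>, so its slope tends to a limit \<open>\<le> - 2\<close>, whereas
  \<open>E \<le> 2\<pi> - \<delta>\<close> forces that slope to stay above \<open>- 2\<close> by a fixed amount.
\<close>

section \<open>Integrals over the circle depending on a parameter\<close>

abbreviation circle_int :: "(real \<Rightarrow> real) \<Rightarrow> real" where
  "circle_int f \<equiv> integral {0..2*pi} f"

abbreviation jcont :: "(real \<Rightarrow> real \<Rightarrow> real) \<Rightarrow> bool" where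
  "jcont f \<equiv> continuous_on UNIV (\<lambda>x. f (fst x) (snd x))"

lemma jcont_compose:
  assumes "jcont f" "continuous_on S g" "continuous_on S h"
  shows "continuous_on S (\<lambda>x. f (g x) (h x))"
  using continuous_on_compose2[OF assms(1) continuous_on_Pair[OF assms(2,3)]] by simp

text \<open>Leibniz rule: joint continuity of the derivative permits differentiation under the
  integral over the compact circle.\<close>

lemma circle_int_deriv:
  assumes d: "\<And>t p. ((\<lambda>t. f t p) has_real_derivative f' t p) (at t)"
    and c: "jcont f" "jcont f'"
  shows "((\<lambda>t. circle_int (f t)) has_real_derivative circle_int (f' t)) (at t)"
proof -
  have "((\<lambda>x. integral (cbox 0 (2*pi)) (f x)) has_field_derivative integral (cbox 0 (2*pi)) (f' t))
    (at t within UNIV)"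
  proof (rule leibniz_rule_field_derivative)
    show "f x integrable_on cbox 0 (2*pi)" for x
      by (intro integrable_continuous jcont_compose[OF c(1)] continuous_intros)
    show "continuous_on (UNIV \<times> cbox 0 (2*pi)) (\<lambda>(x, t). f' x t)"
      unfolding split_beta by (intro jcont_compose[OF c(2)] continuous_intros)
  qed (use d in auto)
  then show ?thesis by simp
qed

lemma circle_int_cont:
  assumes c: "jcont f"
  shows "continuous_on S (\<lambda>t. circle_int (f t))"
proof -
  have "continuous_on S (\<lambda>t. integral (cbox 0 (2*pi)) (f t))"
    by (rule integral_continuous_on_param)
      (unfold split_beta, intro jcont_compose[OF c] continuous_intros)
  then show ?thesis by simp
qed

text \<open>Integration by parts on the circle: by the fundamental theorem of calculus an exact
  angular derivative leaves only boundary terms, and these cancel.\<close>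

lemma circle_int_periodic:
  assumes "\<And>p. (f has_real_derivative f' p) (at p)" "f (2*pi) = f 0"
  shows "circle_int f' = 0"
proof -
  have "(f' has_integral (f (2*pi) - f 0)) {0..2*pi}"
    by (rule fundamental_theorem_of_calculus)
      (use assms(1) in \<open>auto simp: has_real_derivative_iff_has_vector_derivative[symmetric]
        intro: has_field_derivative_at_within\<close>)
  then show ?thesis using assms(2) by (simp add: integral_unique)
qed

lemma circle_int_const [simp]: "circle_int (\<lambda>_. c) = 2*pi*c"
  by simp

lemma circle_int_mono:
  assumes "continuous_on UNIV f" "continuous_on UNIV g" "\<And>p. p \<in> {0..2*pi} \<Longrightarrow> f p \<le> g p"
  shows "circle_int f \<le> circle_int g"
  by (intro integral_le integrable_continuous_interval continuous_on_subset[OF assms(1)]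
      continuous_on_subset[OF assms(2)]) (auto simp: assms(3))

lemma circle_int_add:
  assumes "continuous_on UNIV f" "continuous_on UNIV g"
  shows "circle_int (\<lambda>p. f p + g p) = circle_int f + circle_int g"
  by (intro integral_add integrable_continuous_interval continuous_on_subset[OF assms(1)]
      continuous_on_subset[OF assms(2)]) auto

lemma circle_int_diff:
  assumes "continuous_on UNIV f" "continuous_on UNIV g"
  shows "circle_int (\<lambda>p. f p - g p) = circle_int f - circle_int g"
  by (intro integral_diff integrable_continuous_interval continuous_on_subset[OF assms(1)]
      continuous_on_subset[OF assms(2)]) auto

lemma circle_int_nonneg:
  assumes "continuous_on UNIV f" "\<And>p. f p \<ge> 0"
  shows "circle_int f \<ge> 0"
  using circle_int_mono[of "\<lambda>_. 0" f] assms by simp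

lemma circle_int_variance:
  assumes c: "continuous_on UNIV f"
  shows "circle_int (\<lambda>p. (f p - circle_int f / (2*pi))\<^sup>2)
    = circle_int (\<lambda>p. (f p)\<^sup>2) - (circle_int f)\<^sup>2 / (2*pi)"
proof -
  define m where "m = circle_int f / (2*pi)"
  have "circle_int (\<lambda>p. (f p - m)\<^sup>2) = circle_int (\<lambda>p. (f p)\<^sup>2 - 2 * m * f p + m\<^sup>2)"
    by (simp add: power2_diff algebra_simps)
  also have "\<dots> = circle_int (\<lambda>p. (f p)\<^sup>2) - 2 * m * circle_int f + 2*pi*m\<^sup>2"
    by (subst circle_int_add circle_int_diff; (intro continuous_intros c)?)+ simp
  also have "\<dots> = circle_int (\<lambda>p. (f p)\<^sup>2) - (circle_int f)\<^sup>2 / (2*pi)"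
    by (simp add: m_def field_simps power2_eq_square)
  finally show ?thesis unfolding m_def .
qed

text \<open>The variance in \<open>circle_int_variance\<close> is an integral of a square, hence
  nonnegative.\<close>

lemma circle_int_cauchy:
  assumes c: "continuous_on UNIV f"
  shows "(circle_int f)\<^sup>2 / (2*pi) \<le> circle_int (\<lambda>p. (f p)\<^sup>2)"
  using circle_int_variance[OF c]
    circle_int_nonneg[of "\<lambda>p. (f p - circle_int f / (2*pi))\<^sup>2"] c
  by (simp add: continuous_intros)

text \<open>The second difference of \<open>f\<close> over a square of side \<open>h\<close> is, by
  two applications of the mean value theorem in either order, \<open>h * h\<close> times a value of
  \<open>f12\<close> and also of \<open>f21\<close> inside the square. Shrinking the squares to the
  corner and using joint continuity identifies the two at that corner.\<close>

lemma mixed_partials_eq: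
  fixes f :: "real \<Rightarrow> real \<Rightarrow> real"
  assumes fx: "\<And>x y. ((\<lambda>x. f x y) has_real_derivative f1 x y) (at x)"
    and fy: "\<And>x y. ((\<lambda>y. f x y) has_real_derivative f2 x y) (at y)"
    and fxy: "\<And>x y. ((\<lambda>y. f1 x y) has_real_derivative f12 x y) (at y)"
    and fyx: "\<And>x y. ((\<lambda>x. f2 x y) has_real_derivative f21 x y) (at x)"
    and c: "jcont f12" "jcont f21"
  shows "f12 x y = f21 x y"
proof -
  have ex: "\<exists>\<xi> \<eta> \<xi>' \<eta>'. x < \<xi> \<and> \<xi> < x + h \<and> y < \<eta> \<and> \<eta> < y + h \<and>
      x < \<xi>' \<and> \<xi>' < x + h \<and> y < \<eta>' \<and> \<eta>' < y + h \<and> f12 \<xi> \<eta> = f21 \<xi>' \<eta>'" if h: "h > 0" for h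
  proof -
    have "\<exists>\<xi>>x. \<xi> < x + h \<and> (f (x+h) (y+h) - f (x+h) y) - (f x (y+h) - f x y)
        = (x + h - x) * (f1 \<xi> (y+h) - f1 \<xi> y)"
      using h by (intro MVT2[of x "x+h" "\<lambda>x. f x (y+h) - f x y"] DERIV_diff fx) auto
    then obtain \<xi> where 1: "x < \<xi>" "\<xi> < x + h" "(f (x+h) (y+h) - f (x+h) y) - (f x (y+h) - f x y)
        = h * (f1 \<xi> (y+h) - f1 \<xi> y)" by auto
    have "\<exists>\<eta>>y. \<eta> < y + h \<and> f1 \<xi> (y+h) - f1 \<xi> y = (y + h - y) * f12 \<xi> \<eta>"
      using h by (intro MVT2 fxy) auto
    then obtain \<eta> where 2: "y < \<eta>" "\<eta> < y + h" "f1 \<xi> (y+h) - f1 \<xi> y = h * f12 \<xi> \<eta>" by auto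
    have "\<exists>\<xi>>y. \<xi> < y + h \<and> (f (x+h) (y+h) - f x (y+h)) - (f (x+h) y - f x y)
        = (y + h - y) * (f2 (x+h) \<xi> - f2 x \<xi>)"
      using h by (intro MVT2[of y "y+h" "\<lambda>y. f (x+h) y - f x y"] DERIV_diff fy) auto
    then obtain \<eta>' where 3: "y < \<eta>'" "\<eta>' < y + h" "(f (x+h) (y+h) - f x (y+h)) - (f (x+h) y - f x y)
        = h * (f2 (x+h) \<eta>' - f2 x \<eta>')" by auto
    have "\<exists>\<eta>>x. \<eta> < x + h \<and> f2 (x+h) \<eta>' - f2 x \<eta>' = (x + h - x) * f21 \<eta> \<eta>'"
      using h by (intro MVT2 fyx) auto
    then obtain \<xi>' where 4: "x < \<xi>'" "\<xi>' < x + h" "f2 (x+h) \<eta>' - f2 x \<eta>' = h * f21 \<xi>' \<eta>'" by auto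
    have "h * h * f12 \<xi> \<eta> = h * h * f21 \<xi>' \<eta>'"
      using 1(3) 2(3) 3(3) 4(3) by (simp add: algebra_simps)
    then have "f12 \<xi> \<eta> = f21 \<xi>' \<eta>'" using h by simp
    then show ?thesis using 1 2 3 4 by blast
  qed
  define h where "h n = inverse (real (Suc n))" for n
  have h0: "h n > 0" for n by (simp add: h_def)
  have hl: "h \<longlonglongrightarrow> 0" unfolding h_def by (rule LIMSEQ_inverse_real_of_nat)
  have "\<forall>n. \<exists>\<xi> \<eta> \<xi>' \<eta>'. (x < \<xi> \<and> \<xi> < x + h n) \<and> (y < \<eta> \<and> \<eta> < y + h n) \<and>
      (x < \<xi>' \<and> \<xi>' < x + h n) \<and> (y < \<eta>' \<and> \<eta>' < y + h n) \<and> f12 \<xi> \<eta> = f21 \<xi>' \<eta>'"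
    using ex[OF h0] by (simp add: conj_assoc)
  then obtain \<xi> \<eta> \<xi>' \<eta>' where q: "\<And>n. x < \<xi> n \<and> \<xi> n < x + h n" "\<And>n. y < \<eta> n \<and> \<eta> n < y + h n"
      "\<And>n. x < \<xi>' n \<and> \<xi>' n < x + h n" "\<And>n. y < \<eta>' n \<and> \<eta>' n < y + h n"
      "\<And>n. f12 (\<xi> n) (\<eta> n) = f21 (\<xi>' n) (\<eta>' n)"
    unfolding choice_iff by blast
  have sq: "s \<longlonglongrightarrow> z" if "\<And>n. z < s n \<and> s n < z + h n" for s :: "nat \<Rightarrow> real" and z
    by (rule tendsto_sandwich[of "\<lambda>_. z" _ _ "\<lambda>n. z + h n"])
      (use that hl tendsto_add[of "\<lambda>_. z" z _ h 0] in \<open>auto intro!: always_eventually less_imp_le\<close>)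
  have "(\<lambda>n. (\<xi> n, \<eta> n)) \<longlonglongrightarrow> (x, y)" "(\<lambda>n. (\<xi>' n, \<eta>' n)) \<longlonglongrightarrow> (x, y)"
    by (intro tendsto_Pair sq q)+
  then have "(\<lambda>n. f12 (\<xi> n) (\<eta> n)) \<longlonglongrightarrow> f12 x y" "(\<lambda>n. f21 (\<xi>' n) (\<eta>' n)) \<longlonglongrightarrow> f21 x y"
    using continuous_on_tendsto_compose[OF c(1), of "\<lambda>n. (\<xi> n, \<eta> n)" "(x,y)" sequentially]
      continuous_on_tendsto_compose[OF c(2), of "\<lambda>n. (\<xi>' n, \<eta>' n)" "(x,y)" sequentially] by simp_all
  then show ?thesis using q(5) LIMSEQ_unique by auto
qed

text \<open>These are bounds for the cutoff \<open>X\<close> of \<open>good_time\<close> and its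
  second derivative. With v = s(1-s) in [0, 1/4] the second factor is 12 - 56 v, which lies in
  [-2, 12]; so X'' is at most 12 times the square root of \<open>X\<close>.\<close>

lemma cutoff_bounds:
  fixes s :: real assumes "0 \<le> s" "s \<le> 1"
  shows "\<bar>(s*(1-s))\<^sup>2 * (12 - 56 * s + 56 * s\<^sup>2)\<bar> \<le> 12 * (s*(1-s))\<^sup>2" "((s*(1-s))\<^sup>2)\<^sup>2 \<le> 1"
proof -
  have "s*(1-s) \<le> 1" "0 \<le> s*(1-s)" using assms by (auto simp: mult_le_one)
  then show "((s*(1-s))\<^sup>2)\<^sup>2 \<le> 1" by (simp add: power_le_one)
  have "0 \<le> (1/2-s)\<^sup>2" by simp
  then have "s*(1-s) \<le> 1/4" by (simp add: power2_eq_square algebra_simps)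
  then have "\<bar>12 - 56 * s + 56 * s\<^sup>2\<bar> \<le> 12"
    using \<open>0 \<le> s*(1-s)\<close> by (simp add: power2_eq_square algebra_simps abs_le_iff)
  then show "\<bar>(s*(1-s))\<^sup>2 * (12 - 56 * s + 56 * s\<^sup>2)\<bar> \<le> 12 * (s*(1-s))\<^sup>2"
    using mult_left_mono[of "\<bar>12 - 56 * s + 56 * s\<^sup>2\<bar>" 12 "(s*(1-s))\<^sup>2"]
    unfolding abs_mult by (simp only: abs_power2 zero_le_power2 mult.commute simp_thms)
qed

text \<open>
  The cylinder form of the problem: \<open>wt\<close>, \<open>wp\<close>, ... are the partial derivatives of \<open>w\<close> in the radial
  variable \<open>t = ln |x|\<close> and the angle \<open>p\<close>, measured from the axis of the cone.
\<close>

locale cylinder_solution =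
  fixes w wt wp wtt wtp wpp G Gt :: "real \<Rightarrow> real \<Rightarrow> real" and C c1 c2 \<gamma> \<theta> t1 M B :: real
  assumes w_t: "((\<lambda>t. w t p) has_real_derivative wt t p) (at t)"
    and w_p: "((\<lambda>p. w t p) has_real_derivative wp t p) (at p)"
    and wt_t: "((\<lambda>t. wt t p) has_real_derivative wtt t p) (at t)"
    and wt_p: "((\<lambda>p. wt t p) has_real_derivative wtp t p) (at p)"
    and wp_t: "((\<lambda>t. wp t p) has_real_derivative wtp t p) (at t)"
    and wp_p: "((\<lambda>p. wp t p) has_real_derivative wpp t p) (at p)"
    and G_t: "((\<lambda>t. G t p) has_real_derivative Gt t p) (at t)"
    and jcont: "jcont w" "jcont wt" "jcont wp" "jcont wtt" "jcont wtp" "jcont wpp" "jcont G" "jcont Gt"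
    and periodic: "w t (2*pi) = w t 0" "wt t (2*pi) = wt t 0" "wp t (2*pi) = wp t 0"
    and pde: "wtt t p + wpp t p = - (G t p * exp (2*t + 2 * w t p))"
    and Gt_nonpos: "Gt t p \<le> 0"
    and C: "0 \<le> C" "w t p \<le> C"
    and c12: "0 < c1" "0 < c2" "2 \<le> \<gamma>" and \<theta>: "0 < \<theta>" "\<theta> \<le> pi" and t1: "0 \<le> t1"
    and G_upper: "t1 \<le> t \<Longrightarrow> \<bar>G t p\<bar> \<le> c2 * exp (\<gamma> * t)"
    and G_lower: "t1 \<le> t \<Longrightarrow> 0 \<le> p \<Longrightarrow> p \<le> \<theta> \<Longrightarrow> c1 * exp (\<gamma> * t) \<le> \<bar>G t p\<bar>"
    and mass: "0 \<le> T \<Longrightarrow> integral {0..T} (\<lambda>t. circle_int (\<lambda>p. \<bar>G t p * exp (2*t + 2 * w t p)\<bar>)) \<le> M"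
    and B: "0 \<le> B" "t \<le> 0 \<Longrightarrow> \<bar>wt t p\<bar> \<le> B * exp t" "t \<le> 0 \<Longrightarrow> \<bar>wp t p\<bar> \<le> B * exp t"
      "t \<le> 0 \<Longrightarrow> \<bar>G t p\<bar> \<le> B"
begin

section \<open>The Pohozaev energy and the circle averages\<close>

lemmas cont_intros [continuous_intros] = jcont[THEN jcont_compose]

definition F where "F t p = G t p * exp (2*t + 2 * w t p)"
definition a where "a t = circle_int (\<lambda>p. \<bar>F t p\<bar>)"
text \<open>The angular Dirichlet energy. The averages \<open>ub\<close> and \<open>ub'\<close>
  below are defined separately; that the second is the derivative of the first is
  \<open>ub_t\<close>.\<close>

definition P where "P t = circle_int (\<lambda>p. (wp t p)\<^sup>2)"
definition ub where "ub t = circle_int (w t) / (2*pi)"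
definition ub' where "ub' t = circle_int (wt t) / (2*pi)"
definition Fb where "Fb t = circle_int (F t)"
definition E where "E t = circle_int (\<lambda>p. (wt t p + 1)\<^sup>2 - (wp t p)\<^sup>2 + F t p)"

lemma jcont_F: "jcont F"
  unfolding F_def by (intro continuous_intros)

lemmas cont_F [continuous_intros] = jcont_F[THEN jcont_compose]

lemma pde_F: "wtt t p = - wpp t p - F t p"
  using pde[of t p] by (simp add: F_def)

lemma F_t: "((\<lambda>t. F t p) has_real_derivative
    Gt t p * exp (2*t + 2 * w t p) + 2 * F t p * (wt t p + 1)) (at t)"
  unfolding F_def
  by (rule derivative_eq_intros G_t w_t refl)+ (simp add: algebra_simps)

text \<open>After substituting the equation for \<open>wtt\<close>, the terms
  \<open>2 * F * (wt + 1)\<close> cancel, and what remains besides the \<open>Gt\<close> term is -2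
  times the angular derivative of \<open>(wt + 1) * wp\<close>, which integrates to zero.\<close>

lemma E_t: "(E has_real_derivative circle_int (\<lambda>p. Gt t p * exp (2*t + 2 * w t p))) (at t)"
proof -
  let ?d = "\<lambda>t p. Gt t p * exp (2*t + 2 * w t p) - 2 * (wtp t p * wp t p + (wt t p + 1) * wpp t p)"
  have 1: "(E has_real_derivative circle_int (?d t)) (at t)"
    unfolding E_def
  proof (rule circle_int_deriv)
    show "((\<lambda>t. (wt t p + 1)\<^sup>2 - (wp t p)\<^sup>2 + F t p) has_real_derivative ?d t p) (at t)" for t p
      by (rule derivative_eq_intros wt_t wp_t F_t refl)+ (simp add: pde_F algebra_simps)
  qed (intro continuous_intros)+
  have "circle_int (\<lambda>p. wtp t p * wp t p + (wt t p + 1) * wpp t p) = 0"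
    by (rule circle_int_periodic[of "\<lambda>p. (wt t p + 1) * wp t p"])
      (auto simp: periodic intro!: derivative_eq_intros wt_p wp_p)
  then have "circle_int (\<lambda>p. 2 * (wtp t p * wp t p + (wt t p + 1) * wpp t p)) = 0"
    by (simp only: integral_mult_right mult_zero_right)
  then have "circle_int (\<lambda>p. ?d t p) = circle_int (\<lambda>p. Gt t p * exp (2*t + 2 * w t p))"
    by (subst circle_int_diff) (intro continuous_intros | simp only: diff_0_right)+
  then show ?thesis using 1 by (simp only:)
qed

lemma ub_t: "(ub has_real_derivative ub' t) (at t)"
  unfolding ub_def ub'_def
  by (intro DERIV_cdivide circle_int_deriv w_t) (intro continuous_intros)+

lemma circle_int_wpp: "circle_int (wpp t) = 0"
  using circle_int_periodic[OF wp_p] periodic by blast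

lemma ub'_t: "(ub' has_real_derivative - Fb t / (2*pi)) (at t)"
proof -
  have "circle_int (wtt t) = circle_int (\<lambda>p. - wpp t p - F t p)"
    by (simp add: pde_F[abs_def])
  also have "\<dots> = - circle_int (wpp t) - circle_int (F t)"
    by (subst circle_int_diff; (intro continuous_intros)?) simp
  finally have "circle_int (wtt t) = - Fb t" by (simp add: circle_int_wpp Fb_def)
  moreover have "(ub' has_real_derivative circle_int (wtt t) / (2*pi)) (at t)"
    unfolding ub'_def
    by (intro DERIV_cdivide circle_int_deriv wt_t) (intro continuous_intros)+
  ultimately show ?thesis by simp
qed

lemma a_nonneg: "0 \<le> a t"
  unfolding a_def by (intro circle_int_nonneg continuous_intros) auto

lemma P_nonneg: "0 \<le> P t"
  unfolding P_def by (intro circle_int_nonneg continuous_intros) auto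

lemma Fb_le: "\<bar>Fb t\<bar> \<le> a t"
proof -
  have "Fb t \<le> a t" unfolding Fb_def a_def by (intro circle_int_mono continuous_intros) auto
  moreover have "circle_int (\<lambda>p. - \<bar>F t p\<bar>) \<le> Fb t"
    unfolding Fb_def by (intro circle_int_mono continuous_intros) auto
  ultimately show ?thesis by (simp add: a_def)
qed

lemma circle_int_wt: "circle_int (wt t) = 2*pi*ub' t"
  by (simp add: ub'_def)

lemma circle_int_w: "circle_int (w t) = 2*pi*ub t"
  by (simp add: ub_def)

text \<open>Cauchy-Schwarz for \<open>wt + 1\<close>, whose circle mean is \<open>1 + ub'\<close>:
  at times when \<open>P\<close> and \<open>a\<close> are small, the energy controls the slope of
  the average.\<close>

lemma E_ge: "2*pi*(1 + ub' t)\<^sup>2 - P t - a t \<le> E t"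
proof -
  have "circle_int (\<lambda>p. wt t p + 1) = 2*pi*(1 + ub' t)"
    by (subst circle_int_add; (intro continuous_intros)?) (simp add: ub'_def distrib_left)
  then have "2*pi*(1 + ub' t)\<^sup>2 = (circle_int (\<lambda>p. wt t p + 1))\<^sup>2 / (2*pi)"
    by (simp add: field_simps power2_eq_square)
  also have "\<dots> \<le> circle_int (\<lambda>p. (wt t p + 1)\<^sup>2)"
    by (intro circle_int_cauchy continuous_intros)
  also have "\<dots> = E t + P t - Fb t"
    unfolding E_def P_def Fb_def
    by (subst circle_int_add circle_int_diff; (intro continuous_intros)?)+ simp
  finally show ?thesis using Fb_le[of t] by linarith
qed

section \<open>Oscillation on a circle and its second derivative in time\<close>

lemma circle_int_abs_wp: "circle_int (\<lambda>p. \<bar>wp t p\<bar>) \<le> sqrt (2*pi*P t)"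
proof (rule real_le_rsqrt)
  have "(circle_int (\<lambda>p. \<bar>wp t p\<bar>))\<^sup>2 / (2*pi) \<le> circle_int (\<lambda>p. \<bar>wp t p\<bar>\<^sup>2)"
    by (intro circle_int_cauchy continuous_intros)
  then show "(circle_int (\<lambda>p. \<bar>wp t p\<bar>))\<^sup>2 \<le> 2*pi*P t"
    by (simp add: P_def field_simps)
qed

lemma w_oscillation:
  assumes "p \<in> {0..2*pi}" "q \<in> {0..2*pi}"
  shows "\<bar>w t p - w t q\<bar> \<le> circle_int (\<lambda>p. \<bar>wp t p\<bar>)"
proof -
  have *: "\<bar>w t q - w t p\<bar> \<le> circle_int (\<lambda>p. \<bar>wp t p\<bar>)" if "0 \<le> p" "p \<le> q" "q \<le> 2*pi" for p q
  proof -
    have "(wp t has_integral (w t q - w t p)) {p..q}"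
      using that by (intro fundamental_theorem_of_calculus)
       (auto simp: has_real_derivative_iff_has_vector_derivative[symmetric]
        intro: has_field_derivative_at_within w_p)
    then have "w t q - w t p = integral {p..q} (wp t)" by (simp add: integral_unique)
    also have "\<bar>\<dots>\<bar> \<le> integral {p..q} (\<lambda>p. \<bar>wp t p\<bar>)"
      using integral_norm_bound_integral[of "wp t" "{p..q}" "\<lambda>p. \<bar>wp t p\<bar>"]
      by (simp add: integrable_continuous_interval continuous_intros)
    also have "\<dots> \<le> circle_int (\<lambda>p. \<bar>wp t p\<bar>)"
      using that by (intro integral_subset_le integrable_continuous_interval continuous_intros) auto
    finally show ?thesis .
  qed
  show ?thesis using *[of p q] *[of q p] assms by (cases "p \<le> q") auto
qed

text \<open>Averaging \<open>w_oscillation\<close> over the second angle compares \<open>w\<close>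
  with its mean; Cauchy-Schwarz then replaces the total variation by the Dirichlet energy.\<close>

lemma w_ub_le:
  assumes "p \<in> {0..2*pi}"
  shows "\<bar>w t p - ub t\<bar> \<le> sqrt (2*pi*P t)"
proof -
  let ?J = "circle_int (\<lambda>p. \<bar>wp t p\<bar>)"
  have osc: "w t q \<le> w t p + ?J" "w t p - ?J \<le> w t q" if "q \<in> {0..2*pi}" for q
    using w_oscillation[OF assms that, of t] by linarith+
  have "circle_int (\<lambda>q. w t q) \<le> circle_int (\<lambda>q. w t p + ?J)"
    by (intro circle_int_mono continuous_intros) (fact osc)
  moreover have "circle_int (\<lambda>q. w t p - ?J) \<le> circle_int (\<lambda>q. w t q)"
    by (intro circle_int_mono continuous_intros) (fact osc)
  ultimately have "2*pi*(w t p - ?J) \<le> 2*pi*ub t" "2*pi*ub t \<le> 2*pi*(w t p + ?J)"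
    unfolding circle_int_w by simp_all
  then have "w t p - ?J \<le> ub t" "ub t \<le> w t p + ?J" by (simp_all only: mult_le_cancel_left_pos pi_gt_zero mult_pos_pos zero_less_numeral)
  then show ?thesis using circle_int_abs_wp[of t] by linarith
qed

text \<open>\<open>y\<close> is the squared \<open>L\<^sup>2\<close> norm of the oscillation \<open>w - ub\<close>, see \<open>y_eq\<close>.\<close>

definition y where "y t = circle_int (\<lambda>p. (w t p)\<^sup>2) - 2*pi*(ub t)\<^sup>2"
definition y' where "y' t = 2 * circle_int (\<lambda>p. w t p * wt t p) - 4*pi*ub t*ub' t"
definition y'' where "y'' t = 2 * circle_int (\<lambda>p. (wt t p)\<^sup>2 + w t p * wtt t p)
  - 4*pi*(ub' t)\<^sup>2 + 2 * ub t * Fb t"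

lemma y_t: "(y has_real_derivative y' t) (at t)"
proof -
  have "((\<lambda>t. circle_int (\<lambda>p. (w t p)\<^sup>2)) has_real_derivative circle_int (\<lambda>p. 2 * (w t p * wt t p))) (at t)"
    by (rule circle_int_deriv; (intro continuous_intros)?)
      (auto intro!: derivative_eq_intros w_t)
  from DERIV_diff[OF this DERIV_cmult[OF DERIV_power[OF ub_t, of 2], of "2*pi"]]
  show ?thesis unfolding y_def y'_def by (rule DERIV_cong) simp
qed

lemma y'_t: "(y' has_real_derivative y'' t) (at t)"
proof -
  have "((\<lambda>t. circle_int (\<lambda>p. w t p * wt t p)) has_real_derivative
      circle_int (\<lambda>p. (wt t p)\<^sup>2 + w t p * wtt t p)) (at t)"
    by (rule circle_int_deriv; (intro continuous_intros)?)
      (auto intro!: derivative_eq_intros w_t wt_t simp: power2_eq_square)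
  from DERIV_diff[OF DERIV_cmult[OF this, of 2] DERIV_cmult[OF DERIV_mult[OF ub_t ub'_t], of "4*pi"]]
  show ?thesis unfolding y'_def y''_def mult.assoc
    by (rule DERIV_cong) (simp add: power2_eq_square field_simps)
qed

lemma y_eq: "y t = circle_int (\<lambda>p. (w t p - ub t)\<^sup>2)"
  unfolding y_def ub_def by (subst circle_int_variance)
    (auto intro!: continuous_intros simp: power2_eq_square)

text \<open>Inserting the equation and integrating \<open>w * wpp\<close> by parts produces
  \<open>P\<close>. The kinetic part, the integral of \<open>wt\<close> squared minus its mean
  contribution, is nonnegative by Cauchy-Schwarz and is dropped.\<close>

lemma y''_ge: "2 * P t - 2 * circle_int (\<lambda>p. \<bar>w t p\<bar> * \<bar>F t p\<bar>) - 2 * \<bar>ub t\<bar> * a t \<le> y'' t"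
proof -
  have "circle_int (\<lambda>p. wp t p * wp t p + w t p * wpp t p) = 0"
    by (rule circle_int_periodic[of "\<lambda>p. w t p * wp t p"])
      (auto simp: periodic intro!: derivative_eq_intros w_p wp_p)
  then have 1: "circle_int (\<lambda>p. w t p * wpp t p) = - P t"
    by (subst (asm) circle_int_add; (intro continuous_intros)?) (simp add: P_def power2_eq_square)
  have "circle_int (\<lambda>p. (wt t p)\<^sup>2 + w t p * wtt t p)
      = circle_int (\<lambda>p. (wt t p)\<^sup>2 - w t p * wpp t p - w t p * F t p)"
    by (simp add: pde_F algebra_simps)
  also have "\<dots> = circle_int (\<lambda>p. (wt t p)\<^sup>2) + P t - circle_int (\<lambda>p. w t p * F t p)"
    using 1 by (subst circle_int_diff; (intro continuous_intros)?)+ simp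
  finally have 2: "y'' t = 2 * circle_int (\<lambda>p. (wt t p)\<^sup>2) - 4*pi*(ub' t)\<^sup>2
      + 2 * P t - 2 * circle_int (\<lambda>p. w t p * F t p) + 2 * ub t * Fb t"
    by (simp add: y''_def)
  have "(circle_int (wt t))\<^sup>2 / (2*pi) \<le> circle_int (\<lambda>p. (wt t p)\<^sup>2)"
    by (intro circle_int_cauchy continuous_intros)
  then have 3: "2*pi*(ub' t)\<^sup>2 \<le> circle_int (\<lambda>p. (wt t p)\<^sup>2)"
    by (simp add: circle_int_wt power2_eq_square)
  have 4: "circle_int (\<lambda>p. w t p * F t p) \<le> circle_int (\<lambda>p. \<bar>w t p\<bar> * \<bar>F t p\<bar>)"
    by (intro circle_int_mono continuous_intros) (metis abs_ge_self abs_mult)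
  have "\<bar>ub t * Fb t\<bar> \<le> \<bar>ub t\<bar> * a t"
    unfolding abs_mult by (intro mult_left_mono Fb_le) auto
  then show ?thesis using 2 3 4 by linarith
qed

section \<open>Accumulated mass and linear growth of the circle average\<close>

definition A where "A t = integral {0..t} a"

lemma cont_a: "continuous_on S a"
  unfolding a_def by (rule circle_int_cont) (intro continuous_intros)

text \<open>The integral starts at 0, so a two-sided derivative is claimed only where a left
  neighbourhood lies in the range of integration.\<close>

lemma A_t: assumes "0 < t" shows "(A has_real_derivative a t) (at t)"
proof -
  have "((\<lambda>x. integral {0..x} a) has_real_derivative a t) (at t within {0..t+1})"
    by (rule integral_has_real_derivative) (use assms cont_a in auto)
  then show ?thesis using assms at_within_Icc_at[of 0 t "t+1"] by (simp add: A_def[abs_def])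
qed

lemma A_le: "0 \<le> t \<Longrightarrow> A t \<le> M"
  using mass unfolding A_def a_def F_def by blast

lemma A_mono: assumes "0 < s" "s \<le> t" shows "A s \<le> A t"
  by (rule DERIV_nonneg_imp_nondecreasing[OF assms(2)]) (use A_t a_nonneg assms in \<open>meson less_le_trans\<close>)

text \<open>\<open>A\<close> is nondecreasing and bounded by \<open>M\<close>, so past a point where
  it is within \<epsilon> of its supremum all increments are small.\<close>

lemma A_cauchy:
  assumes "0 < \<epsilon>"
  obtains t0 where "0 < t0" "\<And>s t. t0 \<le> s \<Longrightarrow> s \<le> t \<Longrightarrow> A t - A s \<le> \<epsilon>"
proof -
  let ?S = "Sup (A ` {0<..})"
  have bdd: "bdd_above (A ` {0<..})" using A_le by (intro bdd_aboveI2[of _ _ M]) auto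
  have "?S - \<epsilon> < ?S" using assms by simp
  then obtain t0 where t0: "0 < t0" "?S - \<epsilon> < A t0"
    using less_cSup_iff[OF _ bdd, of "?S - \<epsilon>"] by auto
  have "A t - A s \<le> \<epsilon>" if "t0 \<le> s" "s \<le> t" for s t
    using t0 that A_mono[of t0 s] cSup_upper[OF _ bdd, of "A t"] by auto
  then show ?thesis using t0(1) that by blast
qed

text \<open>The derivative of \<open>ub'\<close> is at most \<open>a\<close> in absolute value, and
  \<open>a\<close> is the derivative of \<open>A\<close>; hence \<open>A + ub'\<close> and
  \<open>A - ub'\<close> are both nondecreasing.\<close>

lemma ub'_diff: assumes "0 < s" "s \<le> t" shows "\<bar>ub' t - ub' s\<bar> \<le> A t - A s"
proof -
  have F: "Fb x / (2*pi) \<le> a x" "- (Fb x / (2*pi)) \<le> a x" for x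
  proof -
    have "\<bar>- Fb x / (2*pi)\<bar> = \<bar>Fb x\<bar> / (2*pi)" by simp
    also have "\<dots> \<le> \<bar>Fb x\<bar> / 1" using pi_gt3 by (intro divide_left_mono) auto
    finally have "\<bar>- Fb x / (2*pi)\<bar> \<le> a x" using Fb_le[of x] by simp
    then show "Fb x / (2*pi) \<le> a x" "- (Fb x / (2*pi)) \<le> a x" by (auto simp only: abs_le_iff minus_divide_left minus_minus)
  qed
  have "A s + ub' s \<le> A t + ub' t"
  proof (rule DERIV_nonneg_imp_nondecreasing[OF assms(2)])
    show "\<exists>y. ((\<lambda>t. A t + ub' t) has_real_derivative y) (at x) \<and> 0 \<le> y" if "s \<le> x" for x
      using DERIV_add[OF A_t ub'_t, of x] F(1)[of x] assms that by force
  qed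
  moreover have "A s - ub' s \<le> A t - ub' t"
  proof (rule DERIV_nonneg_imp_nondecreasing[OF assms(2)])
    show "\<exists>y. ((\<lambda>t. A t - ub' t) has_real_derivative y) (at x) \<and> 0 \<le> y" if "s \<le> x" for x
      using DERIV_diff[OF A_t ub'_t, of x] F(2)[of x] assms that by force
  qed
  ultimately show ?thesis by linarith
qed

text \<open>Finite mass bounds the slope through \<open>ub'_diff\<close>; the mean value theorem
  turns this into linear growth.\<close>

lemma ub_growth: obtains D where "0 \<le> D" "\<And>t. 1 \<le> t \<Longrightarrow> \<bar>ub t\<bar> \<le> D * t"
proof
  let ?K = "\<bar>ub' 1\<bar> + M - A 1"
  have K: "\<bar>ub' x\<bar> \<le> ?K" if "1 \<le> x" for x
    using ub'_diff[of 1 x] A_le[of x] that by auto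
  then show D0: "0 \<le> ?K + \<bar>ub 1\<bar>" using K[of 1] by linarith
  show "\<bar>ub t\<bar> \<le> (?K + \<bar>ub 1\<bar>) * t" if "1 \<le> t" for t
  proof (cases "t = 1")
    case True
    then show ?thesis using K[of 1] by simp
  next
    case False
    then obtain z where z: "1 < z" "ub t - ub 1 = (t - 1) * ub' z"
      using MVT2[of 1 t ub ub'] ub_t \<open>1 \<le> t\<close> by auto
    have "\<bar>ub t - ub 1\<bar> \<le> (t - 1) * ?K"
      unfolding z(2) abs_mult using K[of z] z that by (intro mult_mono) auto
    moreover have "\<bar>ub 1\<bar> \<le> \<bar>ub 1\<bar> * t" using that by (simp add: mult_le_cancel_left1)
    moreover have "0 \<le> ?K" using K[of 1] by linarith
    ultimately show ?thesis unfolding distrib_right by (simp add: algebra_simps)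
  qed
qed

text \<open>Where \<open>w\<close> is below a steep linear function, \<open>F\<close> is so small that \<open>\<bar>w F\<bar>\<close> is negligible.\<close>

lemma wF_bound:
  assumes "t1 \<le> t"
  shows "\<bar>w t p\<bar> * \<bar>F t p\<bar> \<le> (C + (\<gamma>+3)*t) * \<bar>F t p\<bar> + c2 * exp (- t)"
proof (cases "- (C + (\<gamma>+3)*t) \<le> w t p")
  case True
  have "0 \<le> (\<gamma>+3)*t" using assms t1 c12 by simp
  then have "\<bar>w t p\<bar> \<le> C + (\<gamma>+3)*t" using True C(2)[of t p] by (auto simp: abs_le_iff)
  then have "\<bar>w t p\<bar> * \<bar>F t p\<bar> \<le> (C + (\<gamma>+3)*t) * \<bar>F t p\<bar>" by (rule mult_right_mono) simp
  then show ?thesis using c12 by (simp add: add_increasing2)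
next
  case False
  have nn: "0 \<le> (\<gamma>+3)*t" using assms t1 c12 by simp
  have w0: "w t p \<le> 0" "w t p \<le> - (\<gamma>+3)*t" using False C(1) nn by (auto simp: algebra_simps)
  have "\<bar>F t p\<bar> \<le> c2 * exp (\<gamma> * t) * exp (2*t + 2 * w t p)"
    unfolding F_def abs_mult using G_upper[OF assms, of p] by (simp add: mult_right_mono)
  moreover have "\<bar>w t p\<bar> \<le> exp (- w t p)"
    using w0 exp_ge_add_one_self[of "- w t p"] by simp
  ultimately have "\<bar>w t p\<bar> * \<bar>F t p\<bar> \<le> exp (- w t p) * (c2 * exp (\<gamma> * t) * exp (2*t + 2 * w t p))"
    by (intro mult_mono) auto
  \<comment> \<open>The slope \<gamma> + 3 is chosen for this exponent: one factor exp(-w) absorbs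
    |w|, leaving (\<gamma> + 2) t + w, which is at most -t.\<close>
  also have "\<dots> = c2 * exp ((\<gamma> + 2) * t + w t p)"
    by (simp add: exp_add[symmetric] mult.left_commute algebra_simps flip: exp_add)
  also have "\<dots> \<le> c2 * exp (- t)"
    using w0 c12 by (auto simp: algebra_simps)
  finally show ?thesis using nn C(1) by (simp add: add_increasing)
qed

section \<open>Interpolation and times of small Dirichlet energy and mass\<close>

lemma y''_lower:
  obtains H where "0 \<le> H" "\<And>t. t1 \<le> t \<Longrightarrow> 1 \<le> t \<Longrightarrow> 2 * P t - H * (t * a t + exp (- t)) \<le> y'' t"
proof -
  obtain D where D: "0 \<le> D" "\<And>t. 1 \<le> t \<Longrightarrow> \<bar>ub t\<bar> \<le> D * t" using ub_growth by blast
  let ?H1 = "2 * (C + \<gamma> + 3 + D)"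
  show ?thesis
  proof
    show "0 \<le> ?H1 + 4*pi*c2" using C c12 D by auto
    fix t assume t: "t1 \<le> t" "1 \<le> t"
    have "circle_int (\<lambda>p. \<bar>w t p\<bar> * \<bar>F t p\<bar>)
        \<le> circle_int (\<lambda>p. (C + (\<gamma>+3)*t) * \<bar>F t p\<bar> + c2 * exp (- t))"
      by (intro circle_int_mono continuous_intros wF_bound t)
    also have "\<dots> = (C + (\<gamma>+3)*t) * a t + 2*pi*(c2 * exp (- t))"
      unfolding a_def by (subst circle_int_add; (intro continuous_intros)?) simp
    also have "(C + (\<gamma>+3)*t) * a t \<le> ((C + (\<gamma>+3))*t) * a t"
      using t C mult_left_mono[of 1 t C] by (intro mult_right_mono a_nonneg) (auto simp: algebra_simps)
    finally have 1: "2 * circle_int (\<lambda>p. \<bar>w t p\<bar> * \<bar>F t p\<bar>) \<le> 2*(C + \<gamma>+3)*(t * a t) + 4*pi*c2 * exp (- t)"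
      by (simp add: algebra_simps)
    have 2: "2 * \<bar>ub t\<bar> * a t \<le> 2 * D * (t * a t)"
      using mult_right_mono[OF D(2)[OF t(2)] a_nonneg[of t]] by (simp add: mult.assoc)
    have 3: "0 \<le> 4*pi*c2 * (t * a t)" "0 \<le> ?H1 * exp (- t)"
      using C c12 D t a_nonneg[of t] by auto
    have "(?H1 + 4*pi*c2) * (t * a t + exp (- t)) = 2*(C + \<gamma>+3)*(t * a t) + 4*pi*c2 * exp (- t)
       + 2 * D * (t * a t) + 4*pi*c2 * (t * a t) + ?H1 * exp (- t)"
      by (simp add: algebra_simps)
    then show "2 * P t - (?H1 + 4*pi*c2) * (t * a t + exp (- t)) \<le> y'' t"
      using y''_ge[of t] 1 2 3 by linarith
  qed
qed

lemma y_nonneg: "0 \<le> y t"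
  unfolding y_eq by (intro circle_int_nonneg continuous_intros) auto

text \<open>The squared L2 norm is at most the sup norm times the L1 norm. The sup norm is bounded
  by \<open>w_ub_le\<close>. The L1 norm grows linearly because \<open>w - ub\<close> has mean zero
  and is bounded above by a linear function.\<close>

lemma y_upper:
  obtains H where "0 \<le> H" "\<And>t. 1 \<le> t \<Longrightarrow> (y t)\<^sup>2 \<le> H * t\<^sup>2 * P t"
proof -
  obtain D where D: "0 \<le> D" "\<And>t. 1 \<le> t \<Longrightarrow> \<bar>ub t\<bar> \<le> D * t" using ub_growth by blast
  let ?N = "C + D"
  show ?thesis
  proof
    show "0 \<le> 2*pi*(4*pi*?N)\<^sup>2" by simp
    fix t :: real assume t: "1 \<le> t"
    let ?r = "sqrt (2*pi*P t)"
    have zu: "w t p - ub t \<le> ?N * t" for p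
      using C(2)[of t p] D(2)[OF t] mult_left_mono[OF t C(1)] by (auto simp: algebra_simps abs_le_iff)
    have "0 \<le> ?N * t" "2 * ?N * t = ?N * t + ?N * t" using C D t by simp_all
    \<comment> \<open>For z below a nonnegative bound b one has |z| = 2 max(z, 0) - z, hence |z| is
      at most 2b - z; this is linear in z, so its integral needs only the mean of z.\<close>
    then have z: "\<bar>w t p - ub t\<bar> \<le> 2 * ?N * t - (w t p - ub t)" for p
      using zu[of p] by linarith
    have "y t \<le> circle_int (\<lambda>p. ?r * (2 * ?N * t - (w t p - ub t)))"
      unfolding y_eq
    proof (intro circle_int_mono continuous_intros)
      fix p assume "p \<in> {0..2*pi}"
      then have "\<bar>w t p - ub t\<bar> * \<bar>w t p - ub t\<bar> \<le> ?r * (2 * ?N * t - (w t p - ub t))"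
        using P_nonneg[of t] by (intro mult_mono w_ub_le z) auto
      then show "(w t p - ub t)\<^sup>2 \<le> ?r * (2 * ?N * t - (w t p - ub t))"
        by (simp add: power2_eq_square)
    qed
    also have "\<dots> = ?r * (circle_int (\<lambda>p. 2 * ?N * t) - (circle_int (w t) - circle_int (\<lambda>p. ub t)))"
      unfolding integral_mult_right
      by (subst circle_int_diff; (intro continuous_intros)?)+ simp
    also have "\<dots> = ?r * (4*pi*?N * t)"
      unfolding circle_int_w circle_int_const by simp
    finally have "(y t)\<^sup>2 \<le> (?r * (4*pi*?N * t))\<^sup>2"
      using y_nonneg by (rule power_mono)
    also have "\<dots> = 2*pi*(4*pi*?N)\<^sup>2 * t\<^sup>2 * P t"
      using P_nonneg[of t] by (simp add: power_mult_distrib)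
    finally show "(y t)\<^sup>2 \<le> 2*pi*(4*pi*?N)\<^sup>2 * t\<^sup>2 * P t" .
  qed
qed

text \<open>
  With \<open>s = t/T - 1\<close> and the cutoff \<open>X s = s\<^sup>4 (1 - s)\<^sup>4\<close> the function \<open>X y' T - X' y\<close> vanishes at both ends
  of \<open>[T, 2T]\<close>. In its derivative \<open>T\<^sup>2 X y'' - X'' y\<close> the bad term \<open>X'' y \<le> 12 \<surd>X y\<close> is absorbed by
  half of \<open>2 T\<^sup>2 X P\<close>, since \<open>y\<^sup>2 \<le> H t\<^sup>2 P\<close>.
\<close>

lemma good_time:
  assumes "0 < \<epsilon>"
  shows "\<exists>t\<ge>T0. P t + a t < \<epsilon>"
proof (rule ccontr)
  assume "\<not> ?thesis"
  then have big: "\<epsilon> \<le> P t + a t" if "T0 \<le> t" for t using that by force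
  obtain H1 where H1: "0 \<le> H1"
      "\<And>t. t1 \<le> t \<Longrightarrow> 1 \<le> t \<Longrightarrow> 2 * P t - H1 * (t * a t + exp (- t)) \<le> y'' t"
    using y''_lower by blast
  obtain H2 where H2: "0 \<le> H2" "\<And>t. 1 \<le> t \<Longrightarrow> (y t)\<^sup>2 \<le> H2 * t\<^sup>2 * P t"
    using y_upper by blast
  \<comment> \<open>2520 is 4 * 630, where 1/630 is the integral of the cutoff over [0, 1]. The
    choices of \<eta> and \<open>T\<close> make each of two error terms at most a quarter of the
    main term.\<close>
  define \<eta> where "\<eta> = \<epsilon> / (2520 * (1 + 2 * H1))"
  have \<eta>: "0 < \<eta>" using assms H1 by (simp add: \<eta>_def)
  obtain t0 where t0: "0 < t0" "\<And>s t. t0 \<le> s \<Longrightarrow> s \<le> t \<Longrightarrow> A t - A s \<le> \<eta>"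
    using A_cauchy[OF \<eta>] by blast
  define T where "T = max (max T0 t1) (max (max 1 t0) ((144 * H2 + H1) * 2520 / \<epsilon>))"
  have T: "T0 \<le> T" "t1 \<le> T" "1 \<le> T" "t0 \<le> T" "(144 * H2 + H1) * 2520 / \<epsilon> \<le> T"
    unfolding T_def by linarith+
  define X where "X s = ((s * (1 - s))\<^sup>2)\<^sup>2" for s :: real
  define X' where "X' s = 4 * (s * (1 - s))^3 * (1 - 2 * s)" for s :: real
  define X'' where "X'' s = (s * (1 - s))\<^sup>2 * (12 - 56 * s + 56 * s\<^sup>2)" for s :: real
  \<comment> \<open>The antiderivative of \<open>X\<close> with \<open>Y 0 = 0\<close>; its value at
    1 is 1/630.\<close>
  define Y where "Y s = s^5/5 - 4 * s^6/6 + 6 * s^7/7 - 4 * s^8/8 + s^9/9" for s :: real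
  have dX: "(X has_real_derivative X' s) (at s)" for s
    unfolding X_def X'_def by (rule derivative_eq_intros refl)+ (simp add: field_simps power_numeral_reduce)
  have dX': "(X' has_real_derivative X'' s) (at s)" for s
    unfolding X''_def X'_def by (rule derivative_eq_intros refl)+ (simp add: field_simps power_numeral_reduce)
  have dY: "(Y has_real_derivative X s) (at s)" for s
    unfolding X_def Y_def by (rule derivative_eq_intros refl | simp)+ (simp add: field_simps power_numeral_reduce)
  let ?t = "\<lambda>s. T * (1 + s)"
  have dt: "(?t has_real_derivative T) (at s)" for s
    by (rule derivative_eq_intros refl | simp)+
  \<comment> \<open>Each error in the differential inequality is compensated by adding its
    antiderivative, so that the integrated inequality becomes monotonicity of \<Psi>. The terms in
    \<open>A\<close> account for the mass.\<close>
  define \<Psi> where "\<Psi> s = (X s * y' (?t s) * T - X' s * y (?t s)) - \<epsilon> * T\<^sup>2 * Y s + 144 * H2 * s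
      + T * (1 + 2 * H1 * T) * A (?t s) + T\<^sup>2 * H1 * exp (- T) * s" for s
  define \<psi> where "\<psi> s = X s * y'' (?t s) * T\<^sup>2 - X'' s * y (?t s) - \<epsilon> * T\<^sup>2 * X s + 144 * H2
      + T\<^sup>2 * (1 + 2 * H1 * T) * a (?t s) + T\<^sup>2 * H1 * exp (- T)" for s
  have "\<Psi> 0 \<le> \<Psi> 1"
  proof (rule DERIV_nonneg_imp_nondecreasing[of 0 1 \<Psi>])
    fix s :: real assume s: "0 \<le> s" "s \<le> 1"
    have t: "T \<le> ?t s" "?t s \<le> 2 * T" "0 < ?t s" using s T(3) by (auto simp: algebra_simps add_pos_nonneg)
    have t': "T0 \<le> ?t s" "t1 \<le> ?t s" "1 \<le> ?t s" using t T by linarith+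
    have "(\<Psi> has_real_derivative \<psi> s) (at s)"
      unfolding \<Psi>_def \<psi>_def
      by (rule derivative_eq_intros refl dX dX' dY DERIV_chain2[OF y_t dt] DERIV_chain2[OF y'_t dt]
          DERIV_chain2[OF A_t dt] t)+ (simp add: algebra_simps power2_eq_square)
    moreover have "0 \<le> \<psi> s"
    proof -
      let ?q = "(s * (1 - s))\<^sup>2" and ?t = "?t s"
      have X: "0 \<le> X s" "X s \<le> 1" using cutoff_bounds(2)[OF s] by (auto simp: X_def)
      have e: "exp (- ?t) \<le> exp (- T)" using t by simp
      have Pn: "0 \<le> P ?t" and an: "0 \<le> a ?t" by (rule P_nonneg a_nonneg)+
      have "(12 * ?q * y ?t)\<^sup>2 \<le> (12 * ?q)\<^sup>2 * (H2 * (2*T)\<^sup>2 * P ?t)"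
      proof -
        have "(y ?t)\<^sup>2 \<le> H2 * ?t\<^sup>2 * P ?t" by (rule H2(2)[OF t'(3)])
        also have "\<dots> \<le> H2 * (2*T)\<^sup>2 * P ?t"
          using t H2(1) Pn by (intro mult_right_mono mult_left_mono power_mono) auto
        finally show ?thesis unfolding power_mult_distrib[of "12 * ?q"] by (rule mult_left_mono) simp
      qed
      also have "\<dots> = 4 * (T\<^sup>2 * X s * P ?t) * (144 * H2)"
        by (simp add: X_def power_mult_distrib)
      also have "\<dots> \<le> (T\<^sup>2 * X s * P ?t + 144 * H2)\<^sup>2"
        using zero_le_power2[of "T\<^sup>2 * X s * P ?t - 144 * H2"]
        by (simp add: power2_eq_square algebra_simps)
      finally have "12 * ?q * y ?t \<le> T\<^sup>2 * X s * P ?t + 144 * H2"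
        by (rule power2_le_imp_le) (use X Pn H2 in auto)
      moreover have "X'' s * y ?t \<le> 12 * ?q * y ?t"
        using cutoff_bounds(1)[OF s] by (intro mult_right_mono y_nonneg) (simp add: X''_def abs_le_iff)
      ultimately have 1: "X'' s * y ?t \<le> T\<^sup>2 * X s * P ?t + 144 * H2" by linarith
      have "H1 * (?t * a ?t + exp (- ?t)) \<le> H1 * (2 * T * a ?t + exp (- T))"
        by (rule mult_left_mono[OF add_mono[OF mult_right_mono[OF t(2) an] e] H1(1)])
      moreover have "0 \<le> H1 * (?t * a ?t + exp (- ?t))"
        by (intro mult_nonneg_nonneg add_nonneg_nonneg H1(1) an less_imp_le[OF t(3)]) simp
      ultimately have "X s * (H1 * (?t * a ?t + exp (- ?t))) \<le> 1 * (H1 * (2 * T * a ?t + exp (- T)))"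
        using X by (intro mult_mono[OF X(2)]) auto
      moreover have "X s * (2 * P ?t - H1 * (?t * a ?t + exp (- ?t))) \<le> X s * y'' ?t"
        using H1(2)[OF t'(2,3)] X by (intro mult_left_mono) auto
      ultimately have "2 * X s * P ?t - H1 * (2 * T * a ?t + exp (- T)) \<le> X s * y'' ?t"
        by (simp add: algebra_simps)
      then have 2: "T\<^sup>2 * (2 * X s * P ?t - H1 * (2 * T * a ?t + exp (- T))) \<le> T\<^sup>2 * (X s * y'' ?t)"
        by (rule mult_left_mono) simp
      have "X s * \<epsilon> \<le> X s * P ?t + 1 * a ?t"
        using mult_left_mono[OF big[OF t'(1)] X(1)] mult_right_mono[OF X(2) an] by (simp add: algebra_simps)
      then have 3: "T\<^sup>2 * (X s * \<epsilon>) \<le> T\<^sup>2 * (X s * P ?t + 1 * a ?t)"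
        by (rule mult_left_mono) simp
      show ?thesis unfolding \<psi>_def using 1 2 3 by (simp add: algebra_simps)
    qed
    ultimately show "\<exists>z. (\<Psi> has_real_derivative z) (at s) \<and> 0 \<le> z" by blast
  qed simp
  \<comment> \<open>Only \<open>Y\<close>, \<open>A\<close> and the linear terms survive, since
    \<open>X\<close> and \<open>X'\<close> vanish at 0 and 1.\<close>
  then have "\<epsilon> * T\<^sup>2 / 630 \<le> 144 * H2 + T * (1 + 2 * H1 * T) * (A (2 * T) - A T) + T\<^sup>2 * H1 * exp (- T)"
    by (simp add: \<Psi>_def X_def X'_def Y_def algebra_simps)
  also have "T * (1 + 2 * H1 * T) * (A (2 * T) - A T) \<le> T * (1 + 2 * H1 * T) * \<eta>"
    using T H1 t0(2)[of T "2*T"] by (intro mult_left_mono) auto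
  also have "T * (1 + 2 * H1 * T) * \<eta> \<le> T * (T + 2 * H1 * T) * \<eta>"
    using T H1 \<eta> by (intro mult_left_mono mult_right_mono) auto
  also have "\<dots> = \<epsilon> * T\<^sup>2 / 2520"
    using H1 by (simp add: \<eta>_def field_simps power2_eq_square)
  also have "T\<^sup>2 * H1 * exp (- T) \<le> T * H1"
  proof -
    have "T \<le> exp T" using exp_ge_add_one_self[of T] by linarith
    then have "T * exp (- T) \<le> 1"
      by (simp add: exp_minus field_simps)
    from mult_left_mono[OF this, of "T * H1"] show ?thesis
      using T H1 by (simp add: power2_eq_square algebra_simps)
  qed
  also have "144 * H2 + \<epsilon> * T\<^sup>2 / 2520 + T * H1 \<le> T * (144 * H2 + H1) + \<epsilon> * T\<^sup>2 / 2520"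
    using mult_right_mono[OF T(3), of "144 * H2"] H2 by (simp add: algebra_simps)
  also have "T * (144 * H2 + H1) \<le> T * (T * \<epsilon> / 2520)"
    using T assms by (intro mult_left_mono) (auto simp: field_simps)
  finally have "\<epsilon> * T\<^sup>2 / 630 \<le> \<epsilon> * T\<^sup>2 / 1260" by (simp add: power2_eq_square)
  then show False using assms T by (simp add: field_simps)
qed

section \<open>Decay of the circle average and strict loss of energy\<close>

text \<open>When \<open>P\<close> is at most 1, \<open>w\<close> stays within sqrt(2 pi) of its
  mean, so the lower bound for \<open>G\<close> on the cone makes \<open>a\<close> at least a
  constant times exp((\<gamma> + 2) t + 2 ub). As \<open>a\<close> is at most 1 the exponent is
  bounded, and \<gamma> \<ge> 2 gives at least 4t there.\<close>

lemma ub_upper: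
  obtains N where "\<And>t. t1 \<le> t \<Longrightarrow> P t \<le> 1 \<Longrightarrow> a t \<le> 1 \<Longrightarrow> ub t + 2 * t \<le> N"
proof
  fix t assume t: "t1 \<le> t" "P t \<le> 1" "a t \<le> 1"
  let ?x = "(\<gamma> + 2) * t + 2 * (ub t - sqrt (2*pi))"
  have t0: "0 \<le> t" using t t1 by simp
  have "c1 * exp ?x \<le> \<bar>F t p\<bar>" if p: "p \<in> {0..\<theta>}" for p
  proof -
    have "sqrt (2*pi*P t) \<le> sqrt (2*pi)" using t by (simp add: mult_left_le)
    moreover have "\<bar>w t p - ub t\<bar> \<le> sqrt (2*pi*P t)"
      using p \<theta> pi_gt_zero by (intro w_ub_le) auto
    ultimately have "ub t - sqrt (2*pi) \<le> w t p" by linarith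
    then have "exp (2*t + 2 * (ub t - sqrt (2*pi))) \<le> exp (2*t + 2 * w t p)" by simp
    moreover have "c1 * exp (\<gamma> * t) \<le> \<bar>G t p\<bar>" using G_lower[OF t(1)] p by auto
    ultimately have "c1 * exp (\<gamma> * t) * exp (2*t + 2 * (ub t - sqrt (2*pi))) \<le> \<bar>F t p\<bar>"
      unfolding F_def abs_mult using c12 by (intro mult_mono) auto
    then show ?thesis by (simp add: algebra_simps flip: exp_add)
  qed
  then have "integral {0..\<theta>} (\<lambda>p. c1 * exp ?x) \<le> integral {0..\<theta>} (\<lambda>p. \<bar>F t p\<bar>)"
    by (intro integral_le integrable_continuous_interval continuous_intros)
  also have "\<dots> \<le> a t"
    unfolding a_def using \<theta> pi_gt_zero
    by (intro integral_subset_le integrable_continuous_interval continuous_intros) auto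
  also have "integral {0..\<theta>} (\<lambda>p. c1 * exp ?x) = \<theta> * c1 * exp ?x"
    using \<theta> by (simp add: mult_ac)
  finally have "\<theta> * c1 * exp ?x \<le> 1" using t(3) by linarith
  then have "exp ?x \<le> 1 / (\<theta> * c1)" using \<theta> c12 by (simp add: field_simps)
  also have "\<dots> = exp (ln (1 / (\<theta> * c1)))" using \<theta> c12 by simp
  finally have "?x \<le> ln (1 / (\<theta> * c1))" by (simp only: exp_le_cancel_iff)
  moreover have "4 * t \<le> (\<gamma> + 2) * t" using c12 t0 by (intro mult_right_mono) auto
  ultimately show "ub t + 2 * t \<le> ln (1 / (\<theta> * c1)) / 2 + sqrt (2*pi)" by argo
qed

lemma E_antimono: assumes "s \<le> t" shows "E t \<le> E s"
proof (rule DERIV_nonpos_imp_nonincreasing[OF assms])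
  fix x
  have "circle_int (\<lambda>p. Gt x p * exp (2*x + 2 * w x p)) \<le> circle_int (\<lambda>p. 0)"
    by (intro circle_int_mono continuous_intros) (simp add: Gt_nonpos mult_nonpos_nonneg)
  then show "\<exists>z. (E has_real_derivative z) (at x) \<and> z \<le> 0" using E_t by auto
qed

text \<open>\<open>E\<close> is nonincreasing, so it is bounded by its limit at minus infinity.
  There \<open>wt\<close> and \<open>F\<close> decay like exp s by regularity of the solution at the
  origin, and only the constant 1 in the integrand remains.\<close>

lemma E_le: "E t \<le> 2*pi"
proof (rule tendsto_lowerbound)
  define N where "N = 2 * B + B\<^sup>2 + B * exp (2 * C)"
  show "((\<lambda>s. 2*pi*(1 + N * exp s)) \<longlongrightarrow> 2*pi) at_bot"
    using tendsto_mult[OF tendsto_const[of "2*pi"] tendsto_add[OF tendsto_const[of 1]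
        tendsto_mult[OF tendsto_const[of N] exp_at_bot]]] by simp
  have "E t \<le> 2*pi*(1 + N * exp s)" if s: "s \<le> min t 0" for s
  proof -
    have "E t \<le> E s" using s by (intro E_antimono) simp
    also have "E s \<le> circle_int (\<lambda>p. 1 + N * exp s)"
      unfolding E_def
    proof (intro circle_int_mono continuous_intros)
      fix p
      have e: "exp s \<le> 1" using s by simp
      have b: "\<bar>wt s p\<bar> \<le> B * exp s" "\<bar>G s p\<bar> \<le> B" using B s by auto
      have "(wt s p)\<^sup>2 \<le> (B * exp s)\<^sup>2" using b(1) by (simp add: abs_le_square_iff[symmetric])
      also have "\<dots> \<le> B\<^sup>2 * exp s"
        unfolding power_mult_distrib using e
        by (intro mult_left_mono) (simp_all add: power2_eq_square mult_left_le)
      finally have 1: "(wt s p)\<^sup>2 \<le> B\<^sup>2 * exp s" .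
      have "exp (2 * s + 2 * w s p) \<le> exp (s + 2 * C)" using C(2)[of s p] s by simp
      then have "\<bar>F s p\<bar> \<le> B * exp (s + 2 * C)"
        unfolding F_def abs_mult using b B by (intro mult_mono) auto
      then have 2: "F s p \<le> B * exp (2 * C) * exp s" by (simp add: exp_add mult_ac abs_le_iff)
      have "(wt s p + 1)\<^sup>2 = (wt s p)\<^sup>2 + 2 * wt s p + 1" by (simp add: power2_sum)
      then have "(wt s p + 1)\<^sup>2 - (wp s p)\<^sup>2 + F s p \<le> (wt s p)\<^sup>2 + 2 * \<bar>wt s p\<bar> + 1 + F s p"
        using zero_le_power2[of "wp s p"] abs_ge_self[of "wt s p"] by linarith
      then show "(wt s p + 1)\<^sup>2 - (wp s p)\<^sup>2 + F s p \<le> 1 + N * exp s"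
        using 1 2 b(1) by (simp add: N_def algebra_simps)
    qed
    finally show ?thesis by simp
  qed
  then show "\<forall>\<^sub>F s in at_bot. E t \<le> 2*pi*(1 + N * exp s)"
    unfolding eventually_at_bot_linorder by blast
qed simp

text \<open>If the energy never dropped, the nonpositive integrand in \<open>E_t\<close> would
  vanish identically, so \<open>G\<close> would be constant along the ray \<open>p = 0\<close>; this
  contradicts its exponential growth in the cone.\<close>

lemma E_less: obtains t where "E t < 2*pi"
proof (rule ccontr)
  assume "\<not> thesis"
  then have "E = (\<lambda>_. 2*pi)" using E_le that by (metis ext order_le_less)
  then have "circle_int (\<lambda>p. Gt t p * exp (2*t + 2 * w t p)) = 0" for t
    using E_t[of t] DERIV_const[of "2*pi" "at t"] DERIV_unique by metis
  then have 0: "circle_int (\<lambda>p. - (Gt t p * exp (2*t + 2 * w t p))) = 0" for t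
    by simp
  have "- (Gt t 0 * exp (2*t + 2 * w t 0)) = 0" for t
    using 0[of t] by (subst (asm) integral_eq_0_iff)
      (auto intro!: continuous_intros simp: Gt_nonpos mult_nonpos_nonneg)
  then have "Gt t 0 = 0" for t by simp
  then have "G t 0 = G 0 0" for t
    using DERIV_isconst_all[of "\<lambda>t. G t 0"] G_t[of 0] by metis
  then have bd: "c1 * exp (\<gamma> * t) \<le> \<bar>G 0 0\<bar>" if "t1 \<le> t" for t
    using G_lower[OF that, of 0] \<theta> \<open>G t 0 = G 0 0\<close> by simp
  \<comment> \<open>At this time \<open>c1 * (1 + t)\<close> already exceeds the constant value of
    |G|.\<close>
  define t where "t = t1 + \<bar>G 0 0\<bar> / c1"
  have "t \<le> \<gamma> * t" using t1 c12 mult_right_mono[of 1 \<gamma> t] by (simp add: t_def)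
  then have "1 + t \<le> exp (\<gamma> * t)" using exp_ge_add_one_self[of "\<gamma> * t"] by linarith
  then have "c1 * (1 + t) \<le> c1 * exp (\<gamma> * t)" using c12 by (intro mult_left_mono) auto
  also have "\<dots> \<le> \<bar>G 0 0\<bar>" using c12 by (intro bd) (simp add: t_def)
  finally have "c1 * (1 + t) \<le> \<bar>G 0 0\<bar>" .
  moreover have "c1 * (1 + t) = c1 + c1 * t1 + \<bar>G 0 0\<bar>" using c12 by (simp add: t_def algebra_simps)
  moreover have "0 \<le> c1 * t1" using c12 t1 by simp
  ultimately show False using c12 by linarith
qed

section \<open>Contradiction from the slope of the circle average\<close>

lemma no_solution: False
proof -
  obtain tE where tE: "E tE < 2*pi" using E_less by blast
  \<comment> \<open>The energy gap is at least 4 pi d. Half of it is later spent on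
    \<open>P + a\<close> at a good time, which leaves
    \<open>(1 + ub')\<^sup>2 \<le> 1 - d\<close>.\<close>
  define d where "d = min 1 ((2*pi - E tE) / (4*pi))"
  have d: "0 < d" "d \<le> 1" "E tE + 4 * pi * d \<le> 2*pi"
    using tE by (auto simp: d_def min_def field_simps)
  obtain N where N: "\<And>t. t1 \<le> t \<Longrightarrow> P t \<le> 1 \<Longrightarrow> a t \<le> 1 \<Longrightarrow> ub t + 2 * t \<le> N"
    using ub_upper by blast
  have d4: "0 < d/4" using d by simp
  obtain t0 where t0: "0 < t0" "\<And>s t. t0 \<le> s \<Longrightarrow> s \<le> t \<Longrightarrow> A t - A s \<le> d/4"
    using A_cauchy[OF d4] by blast
  \<comment> \<open>The bound 1 makes \<open>ub_upper\<close> applicable; 2 pi d is half of the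
    energy gap.\<close>
  have e: "0 < min 1 (2*pi*d)" using d by simp
  have good: "\<exists>t\<ge>T0. ub t + 2 * t \<le> N \<and> (1 + ub' t)\<^sup>2 \<le> 1 - d" for T0
  proof -
    obtain t where t: "max (max T0 t1) tE \<le> t" "P t + a t < min 1 (2*pi*d)" using good_time[OF e] by blast
    have "2*pi*(1 + ub' t)\<^sup>2 \<le> E t + (P t + a t)" using E_ge[of t] by linarith
    also have "E t \<le> E tE" using t by (intro E_antimono) simp
    finally have "2*pi*(1 + ub' t)\<^sup>2 \<le> 2*pi*(1 - d)" using t(2) d(3) by (simp add: algebra_simps)
    then have "(1 + ub' t)\<^sup>2 \<le> 1 - d" by (simp only: mult_le_cancel_left_pos pi_gt_zero mult_pos_pos zero_less_numeral)
    moreover have "ub t + 2 * t \<le> N" using t P_nonneg[of t] a_nonneg[of t] by (intro N) auto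
    ultimately show ?thesis using t(1) by auto
  qed
  obtain r where r: "t0 \<le> r" "(1 + ub' r)\<^sup>2 \<le> 1 - d" using good by blast
  have "(1 - d/2)\<^sup>2 = 1 - d + (d/2)\<^sup>2" by (simp add: power2_diff)
  then have "(1 + ub' r)\<^sup>2 \<le> (1 - d/2)\<^sup>2"
    using r(2) zero_le_power2[of "d/2"] by linarith
  then have "\<bar>1 + ub' r\<bar> \<le> 1 - d/2" using d by (simp add: abs_le_square_iff[symmetric])
  then have ub'_r: "-2 + d/2 \<le> ub' r" by linarith
  \<comment> \<open>The mass beyond \<open>t0\<close> can change the slope by at most d/4, so the
    bound at the single time \<open>r\<close> persists for all later times.\<close>
  have ub'_ge: "-2 + d/4 \<le> ub' s" if "r \<le> s" for s
    using ub'_diff[of r s] t0(2)[OF r(1) that] t0(1) r(1) that ub'_r by linarith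
  have lin: "ub r + 2 * r + d/4 * (t - r) \<le> ub t + 2 * t" if "r \<le> t" for t
  proof -
    have "ub r - (-2 + d/4) * r \<le> ub t - (-2 + d/4) * t"
    proof (rule DERIV_nonneg_imp_nondecreasing[OF that])
      fix x assume "r \<le> x"
      then show "\<exists>z. ((\<lambda>t. ub t - (-2 + d/4) * t) has_real_derivative z) (at x) \<and> 0 \<le> z"
        using ub'_ge[of x] DERIV_diff[OF ub_t[of x] DERIV_cmult[OF DERIV_ident, of "-2 + d/4"]]
        by (intro exI conjI) auto
    qed
    then show ?thesis by (simp add: algebra_simps diff_divide_distrib)
  qed
  \<comment> \<open>So late that the linear growth in \<open>lin\<close> lifts
    \<open>ub t + 2 * t\<close> to at least \<open>N + 1\<close>.\<close>
  obtain t where t: "max r (r + 4 * (N + 1 - ub r - 2 * r) / d) \<le> t" "ub t + 2 * t \<le> N"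
    using good by blast
  have "N + 1 - ub r - 2 * r \<le> d/4 * (t - r)" using t(1) d(1) by (simp add: field_simps)
  then show False using lin[of t] t by simp
qed

end

section \<open>Calculus in logarithmic polar coordinates\<close>

definition pd :: "(real^2 \<Rightarrow> real) \<Rightarrow> 2 \<Rightarrow> real^2 \<Rightarrow> real" where
  "pd f i x = frechet_derivative f (at x) (axis i 1)"

text \<open>The angle \<open>b\<close> is a rotation offset: it is taken to be the direction of the
  cone axis, so that the axis becomes \<open>p = 0\<close>.\<close>

definition polar_pt :: "real \<Rightarrow> real \<Rightarrow> real \<Rightarrow> real^2" where
  "polar_pt b t p = (exp t * cos (b + p)) *\<^sub>R axis 1 1 + (exp t * sin (b + p)) *\<^sub>R axis 2 1"

lemma C_infinity_pd: "C_infinity f \<Longrightarrow> C_infinity (pd f i)"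
  unfolding C_infinity_def pd_def[abs_def] by (metis C_k.simps(2))

lemma C_infinity_differentiable: "C_infinity f \<Longrightarrow> f differentiable (at x)"
  unfolding C_infinity_def by (metis C_k.simps(2))

lemma C_infinity_continuous: "C_infinity f \<Longrightarrow> continuous_on UNIV f"
  unfolding C_infinity_def by (metis C_k.simps(1))

lemma frechet_derivative_pd:
  assumes "f differentiable (at x)"
  shows "frechet_derivative f (at x) (h1 *\<^sub>R axis 1 1 + h2 *\<^sub>R axis 2 1) = h1 * pd f 1 x + h2 * pd f 2 x"
proof -
  interpret linear "frechet_derivative f (at x)"
    by (rule linear_frechet_derivative[OF assms])
  show ?thesis by (simp add: add scale pd_def)
qed

lemma curve_deriv:
  assumes f: "C_infinity f"
    and x: "(x has_real_derivative x') (at t)" and y: "(y has_real_derivative y') (at t)"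
  shows "((\<lambda>t. f (x t *\<^sub>R axis 1 1 + y t *\<^sub>R axis 2 1)) has_real_derivative
    x' * pd f 1 (x t *\<^sub>R axis 1 1 + y t *\<^sub>R axis 2 1) + y' * pd f 2 (x t *\<^sub>R axis 1 1 + y t *\<^sub>R axis 2 1)) (at t)"
proof -
  let ?q = "\<lambda>t. x t *\<^sub>R axis 1 1 + y t *\<^sub>R axis 2 1 :: real^2"
  have "(?q has_vector_derivative x' *\<^sub>R axis 1 1 + y' *\<^sub>R axis 2 1) (at t)"
    by (auto intro!: derivative_eq_intros x y)
  moreover have "(f has_derivative frechet_derivative f (at (?q t))) (at (?q t))"
    using C_infinity_differentiable[OF f] by (simp add: frechet_derivative_works)
  ultimately have "((\<lambda>t. f (?q t)) has_vector_derivative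
      frechet_derivative f (at (?q t)) (x' *\<^sub>R axis 1 1 + y' *\<^sub>R axis 2 1)) (at t)"
    by (intro vector_derivative_diff_chain_within[of ?q _ t UNIV f, unfolded o_def])
      (auto intro: has_derivative_at_withinI)
  then show ?thesis
    by (simp add: has_real_derivative_iff_has_vector_derivative frechet_derivative_pd[OF C_infinity_differentiable[OF f]])
qed

lemma polar_deriv_t:
  assumes "C_infinity f"
  shows "((\<lambda>t. f (polar_pt b t p)) has_real_derivative
    exp t * (cos (b + p) * pd f 1 (polar_pt b t p) + sin (b + p) * pd f 2 (polar_pt b t p))) (at t)"
proof -
  have "((\<lambda>t. exp t * cos (b + p)) has_real_derivative exp t * cos (b + p)) (at t)"
    "((\<lambda>t. exp t * sin (b + p)) has_real_derivative exp t * sin (b + p)) (at t)"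
    by (auto intro!: derivative_eq_intros)
  from curve_deriv[OF assms this] show ?thesis unfolding polar_pt_def
    by (rule DERIV_cong) (simp add: algebra_simps)
qed

lemma polar_deriv_p:
  assumes "C_infinity f"
  shows "((\<lambda>p. f (polar_pt b t p)) has_real_derivative
    exp t * (cos (b + p) * pd f 2 (polar_pt b t p) - sin (b + p) * pd f 1 (polar_pt b t p))) (at p)"
proof -
  have "((\<lambda>p. exp t * cos (b + p)) has_real_derivative - (exp t * sin (b + p))) (at p)"
    "((\<lambda>p. exp t * sin (b + p)) has_real_derivative exp t * cos (b + p)) (at p)"
    by (auto intro!: derivative_eq_intros)
  from curve_deriv[OF assms this] show ?thesis unfolding polar_pt_def
    by (rule DERIV_cong) (simp add: algebra_simps)
qed

lemma continuous_polar_pt: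
  fixes S :: "'a::t2_space set"
  assumes "continuous_on S g" "continuous_on S h"
  shows "continuous_on S (\<lambda>x. polar_pt b (g x) (h x))"
  unfolding polar_pt_def by (intro continuous_intros assms)

lemma jcont_polar:
  assumes "C_infinity f"
  shows "jcont (\<lambda>t p. f (polar_pt b t p))"
proof -
  have "continuous_on UNIV (\<lambda>x. polar_pt b (fst x) (snd x))"
    by (intro continuous_polar_pt continuous_intros)
  then show ?thesis by (rule continuous_on_compose2[OF C_infinity_continuous[OF assms]]) simp
qed

lemma polar_pt_nth: "polar_pt b t p $ 1 = exp t * cos (b + p)" "polar_pt b t p $ 2 = exp t * sin (b + p)"
  by (simp_all add: polar_pt_def axis_def)

lemma norm_polar_pt: "norm (polar_pt b t p) = exp t"
proof -
  have "(norm (polar_pt b t p))\<^sup>2 = (exp t)\<^sup>2 * ((cos (b+p))\<^sup>2 + (sin (b+p))\<^sup>2)"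
    by (simp add: norm_vec_def L2_set_def sum_2 polar_pt_nth sum_nonneg power_mult_distrib distrib_left
        del: sin_cos_squared_add sin_cos_squared_add2)
  then have "(norm (polar_pt b t p))\<^sup>2 = (exp t)\<^sup>2" by simp
  then show ?thesis by (simp add: power2_eq_iff_nonneg)
qed

lemma Basis_real2: "(Basis :: (real^2) set) = {axis 1 1, axis 2 1}"
  by (auto simp: Basis_vec_def UNIV_2)

lemma sum_Basis_real2: "(\<Sum>b\<in>Basis. f b) = f (axis 1 1 :: real^2) + f (axis 2 1)"
  by (simp add: Basis_real2 axis_eq_axis)

lemma laplacian_pd: "laplacian f x = pd (pd f 1) 1 x + pd (pd f 2) 2 x" for x :: "real^2"
  by (simp add: laplacian_def sum_Basis_real2 pd_def[abs_def])

lemma inner_gradient: "x \<bullet> gradient f x = x$1 * pd f 1 x + x$2 * pd f 2 x" for x :: "real^2"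
  by (simp add: gradient_def sum_Basis_real2 pd_def inner_add_right inner_axis mult.commute)

lemma exists_2: "(\<exists>i::2. Q i) \<longleftrightarrow> Q 1 \<or> Q 2"
  using forall_2[of "\<lambda>i. \<not> Q i"] by blast

section \<open>Change of variables for the mass\<close>

text \<open>The coordinate map to pairs sends boxes to boxes of equal measure, so the integral
  transfers to the product space, where Fubini for continuous functions applies.\<close>

lemma integral_real2:
  fixes k :: "real \<Rightarrow> real \<Rightarrow> real" and a b :: "real^2"
  assumes k: "jcont k"
  shows "integral (cbox a b) (\<lambda>x. k (x$1) (x$2)) = integral {a$1..b$1} (\<lambda>s. integral {a$2..b$2} (k s))"
proof -
  let ?g = "\<lambda>x::real^2. (x$1, x$2)" and ?h = "\<lambda>z. vector [fst z, snd z] :: real^2"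
  let ?k = "\<lambda>z. k (fst z) (snd z)"
  have gim: "?g ` cbox u v = cbox (u$1, u$2) (v$1, v$2)" for u v
  proof (intro equalityI subsetI)
    fix z assume "z \<in> cbox (u$1, u$2) (v$1, v$2)"
    then show "z \<in> ?g ` cbox u v"
      by (intro image_eqI[of _ _ "?h z"]) (auto simp: mem_box_cart forall_2 cbox_Pair_eq)
  qed (auto simp: mem_box_cart)
  have vector_nth: "vector [x$1, x$2] = x" for x :: "real^2"
    by (simp add: vec_eq_iff forall_2)
  have him: "?h ` cbox (u1, u2) (v1, v2) = cbox (vector [u1, u2]) (vector [v1, v2])" for u1 u2 v1 v2
  proof (intro equalityI subsetI)
    fix z assume "z \<in> cbox (vector [u1, u2]) (vector [v1, v2] :: real^2)"
    then show "z \<in> ?h ` cbox (u1, u2) (v1, v2)"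
      by (intro image_eqI[of _ _ "?g z"]) (auto simp: mem_box_cart forall_2 vec_eq_iff cbox_Pair_eq)
  qed (auto simp: mem_box_cart forall_2 cbox_Pair_eq)
  have "(?k has_integral integral (cbox (a$1, a$2) (b$1, b$2)) ?k) (cbox (a$1, a$2) (b$1, b$2))"
    by (intro integrable_integral integrable_continuous continuous_on_subset[OF k]) auto
  then have "((\<lambda>x. ?k (?g x)) has_integral (1 / 1) *\<^sub>R integral (cbox (a$1, a$2) (b$1, b$2)) ?k)
      (?h ` cbox (a$1, a$2) (b$1, b$2))"
  proof (rule has_integral_twiddle[rotated -1])
    show "measure lborel (?g ` cbox u v) = 1 * measure lborel (cbox u v)" for u v
      unfolding gim content_Pair content_cbox_if_cart
      by (auto simp: UNIV_2 interval_eq_empty_cart forall_2 exists_2 content_real_if box_real)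
    show "\<exists>w z. ?h ` cbox u v = cbox w z" for u v
      using him[of "fst u" "snd u" "fst v" "snd v"] unfolding prod.collapse by blast
  qed (use gim in \<open>auto simp: vec_eq_iff forall_2 intro!: continuous_intros\<close>)
  then have "((\<lambda>x. k (x$1) (x$2)) has_integral integral (cbox (a$1, a$2) (b$1, b$2)) ?k) (cbox a b)"
    by (simp add: him vector_nth)
  then have "integral (cbox a b) (\<lambda>x. k (x$1) (x$2)) = integral (cbox (a$1, a$2) (b$1, b$2)) ?k"
    by (rule integral_unique)
  also have "\<dots> = integral (cbox (a$1) (b$1)) (\<lambda>s. integral (cbox (a$2) (b$2)) (\<lambda>y. ?k (s, y)))"
    by (rule integral_prod_continuous) (auto intro: continuous_on_subset[OF k])
  finally show ?thesis by simp
qed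

text \<open>The Jacobian of \<open>polar_pt\<close> is exp(2t), so the left side is the integral of
  \<open>f\<close> over a slit annulus, and \<open>f\<close> is nonnegative elsewhere.\<close>

lemma polar_mass:
  fixes f :: "real^2 \<Rightarrow> real"
  assumes f: "continuous_on UNIV f" "\<And>x. 0 \<le> f x" "f integrable_on UNIV" and T: "0 \<le> T"
  shows "integral {0..T} (\<lambda>t. circle_int (\<lambda>p. exp (2*t) * f (polar_pt b t p))) \<le> integral UNIV f"
proof -
  \<comment> \<open>The rectangle is open so that the angles 0 and 2 pi are excluded and the polar
    map is injective; the boundary does not affect the integral.\<close>
  define S where "S = box (vector [0,0]) (vector [T, 2*pi] :: real^2)"
  let ?g = "\<lambda>x::real^2. polar_pt b (x$1) (x$2)"
  let ?g' = "\<lambda>x h :: real^2. (h$1 * (exp (x$1) * cos (b + x$2)) - h$2 * (exp (x$1) * sin (b + x$2))) *\<^sub>R axis 1 1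
    + (h$1 * (exp (x$1) * sin (b + x$2)) + h$2 * (exp (x$1) * cos (b + x$2))) *\<^sub>R axis 2 1 :: real^2"
  \<comment> \<open>The change of variables theorem takes functions with values in
    \<open>real^'n\<close>, so \<open>f\<close> is wrapped as a one-component vector.\<close>
  let ?F = "\<lambda>x. vec (f x) :: real^1"
  let ?D = "\<lambda>x::real^2. exp (2*x$1) * f (?g x)"
  have det: "\<bar>det (matrix (?g' x))\<bar> = exp (2*x$1)" for x :: "real^2"
  proof -
    have "det (matrix (?g' x)) = (exp (x$1) * cos (b + x$2))\<^sup>2 + (exp (x$1) * sin (b + x$2))\<^sup>2"
      by (simp add: det_2 matrix_def axis_def power2_eq_square)
    also have "\<dots> = exp (x$1) * exp (x$1)"
      by (simp only: power_mult_distrib sin_cos_squared_add2 mult_1_right power2_eq_square[of "exp _"]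
          flip: distrib_left)
    also have "\<dots> = exp (2*x$1)" by (simp flip: exp_add)
    finally show ?thesis by simp
  qed
  have "jcont (\<lambda>t p. exp (2*t) * f (polar_pt b t p))"
    by (intro continuous_intros continuous_on_compose2[OF f(1)] continuous_polar_pt) auto
  note int = integral_real2[OF this]
  have "?D absolutely_integrable_on S"
    unfolding S_def absolutely_integrable_on_open_interval
    by (intro absolutely_integrable_continuous continuous_intros continuous_on_compose2[OF f(1)] continuous_polar_pt) auto
  then have "(\<lambda>x. \<bar>det (matrix (?g' x))\<bar> *\<^sub>R ?F (?g x)) absolutely_integrable_on S"
    unfolding absolutely_integrable_on_1_iff det by simp
  moreover have "integral S (\<lambda>x. \<bar>det (matrix (?g' x))\<bar> *\<^sub>R ?F (?g x)) = vec (integral S ?D)"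
    unfolding integral_on_1_eq det by simp
  moreover have "(?g has_derivative ?g' x) (at x within S)" for x
  proof -
    have nth: "((\<lambda>x::real^2. x$i) has_derivative (\<lambda>h. h$i)) (at x within S)" for i
      by (rule bounded_linear_imp_has_derivative[OF bounded_linear_vec_nth])
    show ?thesis unfolding polar_pt_def
      by (rule derivative_eq_intros nth refl)+ (simp add: fun_eq_iff algebra_simps)
  qed
  moreover have "inj_on ?g S"
  proof (rule inj_onI)
    fix x y assume xy: "x \<in> S" "y \<in> S" "?g x = ?g y"
    have "exp (x$1) = exp (y$1)" using xy(3) by (metis norm_polar_pt)
    then have 1: "x$1 = y$1" by simp
    then have "cos (b + x$2) = cos (b + y$2)" "sin (b + x$2) = sin (b + y$2)"
      using arg_cong[OF xy(3), of "\<lambda>z. z$1"] arg_cong[OF xy(3), of "\<lambda>z. z$2"]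
      by (simp_all add: polar_pt_nth)
    then obtain n where n: "b + x$2 = b + y$2 + 2*pi*real_of_int n"
      using sin_cos_eq_iff[of "b + x$2" "b + y$2"] by auto
    have "\<bar>x$2 - y$2\<bar> < 2*pi" using xy by (auto simp: S_def mem_box_cart forall_2)
    then have "2*pi*\<bar>real_of_int n\<bar> < 2*pi*1" using n by (simp add: abs_mult)
    then have "\<bar>real_of_int n\<bar> < 1" by (simp only: mult_less_cancel_left_pos pi_gt_zero mult_pos_pos zero_less_numeral)
    then have "n = 0" by linarith
    then show "x = y" using n 1 by (simp add: vec_eq_iff forall_2)
  qed
  moreover have "S \<in> sets lebesgue" by (simp add: S_def)
  ultimately have "?F absolutely_integrable_on (?g ` S) \<and> integral (?g ` S) ?F = vec (integral S ?D)"
    using has_absolute_integral_change_of_variables[of S ?g ?g' ?F "vec (integral S ?D)"] by blast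
  then have *: "f absolutely_integrable_on (?g ` S)" "integral (?g ` S) f = integral S ?D"
    unfolding absolutely_integrable_on_1_iff integral_on_1_eq by (simp_all add: vec_eq_iff)
  have "integral {0..T} (\<lambda>t. circle_int (\<lambda>p. exp (2*t) * f (polar_pt b t p))) = integral S ?D"
    using int[of "vector [0,0]" "vector [T, 2*pi]"] by (simp add: S_def integral_open_interval)
  also have "\<dots> \<le> integral UNIV f"
    unfolding *(2)[symmetric] using * f
    by (intro integral_subset_le) (auto simp: absolutely_integrable_on_def)
  finally show ?thesis .
qed

section \<open>From the plane to the cylinder\<close>

definition polar_t :: "real \<Rightarrow> (real^2 \<Rightarrow> real) \<Rightarrow> real \<Rightarrow> real \<Rightarrow> real" where
  "polar_t b f t p = exp t * (cos (b + p) * pd f 1 (polar_pt b t p) + sin (b + p) * pd f 2 (polar_pt b t p))"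

definition polar_p :: "real \<Rightarrow> (real^2 \<Rightarrow> real) \<Rightarrow> real \<Rightarrow> real \<Rightarrow> real" where
  "polar_p b f t p = exp t * (cos (b + p) * pd f 2 (polar_pt b t p) - sin (b + p) * pd f 1 (polar_pt b t p))"

lemmas polar_deriv = polar_deriv_t[folded polar_t_def] polar_deriv_p[folded polar_p_def]

lemma jcont_polar_t: "C_infinity f \<Longrightarrow> jcont (polar_t b f)"
  unfolding polar_t_def by (intro continuous_intros jcont_polar C_infinity_pd)

lemma jcont_polar_p: "C_infinity f \<Longrightarrow> jcont (polar_p b f)"
  unfolding polar_p_def by (intro continuous_intros jcont_polar C_infinity_pd)

lemma polar_pt_periodic: "polar_pt b t (2*pi) = polar_pt b t 0"
  by (simp add: polar_pt_def)

lemma polar_abs_le: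
  "\<bar>polar_t b f t p\<bar> \<le> (\<bar>pd f 1 (polar_pt b t p)\<bar> + \<bar>pd f 2 (polar_pt b t p)\<bar>) * exp t"
  "\<bar>polar_p b f t p\<bar> \<le> (\<bar>pd f 1 (polar_pt b t p)\<bar> + \<bar>pd f 2 (polar_pt b t p)\<bar>) * exp t"
proof -
  have "\<bar>cos (b + p) * y\<bar> \<le> \<bar>y\<bar>" "\<bar>sin (b + p) * y\<bar> \<le> \<bar>y\<bar>" for y
    by (simp_all add: abs_mult mult_left_le_one_le)
  then have *: "\<bar>cos (b + p) * x + sin (b + p) * y\<bar> \<le> \<bar>x\<bar> + \<bar>y\<bar>"
      "\<bar>cos (b + p) * y - sin (b + p) * x\<bar> \<le> \<bar>x\<bar> + \<bar>y\<bar>" for x y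
    by (smt (verit))+
  show "\<bar>polar_t b f t p\<bar> \<le> (\<bar>pd f 1 (polar_pt b t p)\<bar> + \<bar>pd f 2 (polar_pt b t p)\<bar>) * exp t"
    "\<bar>polar_p b f t p\<bar> \<le> (\<bar>pd f 1 (polar_pt b t p)\<bar> + \<bar>pd f 2 (polar_pt b t p)\<bar>) * exp t"
    unfolding polar_t_def polar_p_def abs_mult abs_exp_cancel mult.commute[of "exp t"]
    by (intro mult_right_mono *; simp)+
qed

lemma cylinder_solution_polar:
  fixes K u :: "real^2 \<Rightarrow> real"
  assumes K: "C_infinity K" and u: "C_infinity u"
    and K_radial: "\<And>x. x \<bullet> gradient K x \<le> 0"
    and eq: "\<And>x. - laplacian u x = K x * exp (2 * u x)"
    and C: "\<And>x. u x \<le> C"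
    and int: "integrable lborel (\<lambda>x. \<bar>K x\<bar> * exp (2 * u x))"
    and R1: "0 < R1" and \<theta>: "0 < \<theta>" "\<theta> \<le> pi" and \<gamma>: "2 \<le> \<gamma>" and c12: "0 < c1" "0 < c2"
    and upper: "\<And>x. R1 \<le> norm x \<Longrightarrow> \<bar>K x\<bar> \<le> c2 * norm x powr \<gamma>"
    and lower: "\<And>x. x \<in> circular_cone (polar_pt b 0 0) \<theta> - ball 0 R1 \<Longrightarrow> c1 * norm x powr \<gamma> \<le> \<bar>K x\<bar>"
  shows False
proof -
  let ?q = "polar_pt b"
  let ?M = "integral UNIV (\<lambda>x. \<bar>K x\<bar> * exp (2 * u x))"
  let ?wtp = "\<lambda>t p. exp t * (cos (b + p) * pd u 2 (?q t p) + sin (b + p) * polar_p b (pd u 2) t p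
    + (cos (b + p) * polar_p b (pd u 1) t p - sin (b + p) * pd u 1 (?q t p)))"
  let ?wpt = "\<lambda>t p. polar_p b u t p
    + exp t * (cos (b + p) * polar_t b (pd u 2) t p - sin (b + p) * polar_t b (pd u 1) t p)"
  let ?wtt = "\<lambda>t p. polar_t b u t p
    + exp t * (cos (b + p) * polar_t b (pd u 1) t p + sin (b + p) * polar_t b (pd u 2) t p)"
  let ?wpp = "\<lambda>t p. exp t * (cos (b + p) * polar_p b (pd u 2) t p - sin (b + p) * pd u 2 (?q t p)
    - (cos (b + p) * pd u 1 (?q t p) + sin (b + p) * polar_p b (pd u 1) t p))"
  note Cu = u C_infinity_pd[OF u, of 1] C_infinity_pd[OF u, of 2]
  note jc = jcont_polar[OF K, of b] jcont_polar_t[OF K, of b]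
    Cu[THEN jcont_polar, of b] Cu[THEN jcont_polar_t, of b] Cu[THEN jcont_polar_p, of b]
  have wt_p: "((\<lambda>p. polar_t b u t p) has_real_derivative ?wtp t p) (at p)" for t p
    unfolding polar_t_def[of b u]
    by (rule derivative_eq_intros polar_deriv Cu refl)+ (simp add: algebra_simps)
  have wp_t: "((\<lambda>t. polar_p b u t p) has_real_derivative ?wpt t p) (at t)" for t p
    unfolding polar_p_def[of b u]
    by (rule derivative_eq_intros polar_deriv Cu refl)+ (simp add: algebra_simps)
  have wtp_jc: "jcont ?wtp" and wpt_jc: "jcont ?wpt" by (intro continuous_intros jc)+
  \<comment> \<open>The locale has one function \<open>wtp\<close> for both mixed derivatives,
    whereas the chain rule gives two different expressions.\<close>
  have mixed: "?wtp t p = ?wpt t p" for t p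
    using mixed_partials_eq[OF polar_deriv(1)[OF u] polar_deriv(2)[OF u] wt_p wp_t wtp_jc wpt_jc] by blast
  \<comment> \<open>Nonpositive \<open>t\<close> corresponds to the closed unit ball, where
    compactness bounds the first derivatives of \<open>u\<close> and \<open>K\<close>; the factor
    exp t comes from the chain rule.\<close>
  obtain B where B: "\<And>x. x \<in> cball 0 1 \<Longrightarrow> \<bar>\<bar>pd u 1 x\<bar> + \<bar>pd u 2 x\<bar> + \<bar>K x\<bar>\<bar> \<le> B"
  proof -
    have "bounded ((\<lambda>x. \<bar>pd u 1 x\<bar> + \<bar>pd u 2 x\<bar> + \<bar>K x\<bar>) ` cball 0 1)"
      by (intro compact_imp_bounded compact_continuous_image continuous_intros
          continuous_on_subset[OF C_infinity_continuous] Cu K) auto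
    then obtain B where "\<forall>x\<in>cball 0 1. norm (\<bar>pd u 1 x\<bar> + \<bar>pd u 2 x\<bar> + \<bar>K x\<bar>) \<le> B"
      unfolding bounded_iff ball_simps by blast
    then show ?thesis by (intro that[of B]) (simp only: real_norm_def)
  qed
  have B': "0 \<le> B" "\<bar>pd u 1 (?q t p)\<bar> + \<bar>pd u 2 (?q t p)\<bar> \<le> B" "\<bar>K (?q t p)\<bar> \<le> B" if "t \<le> 0" for t p
  proof -
    have "?q t p \<in> cball 0 1" using that by (simp add: norm_polar_pt)
    from B[OF this] show "0 \<le> B" "\<bar>pd u 1 (?q t p)\<bar> + \<bar>pd u 2 (?q t p)\<bar> \<le> B" "\<bar>K (?q t p)\<bar> \<le> B"
      by linarith+
  qed
  have powr: "exp t powr \<gamma> = exp (\<gamma> * t)" for t by (simp add: powr_def)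
  have ge: "R1 \<le> exp t" if "max 0 (ln R1) \<le> t" for t
  proof -
    have "exp (ln R1) \<le> exp t" using that by simp
    then show ?thesis using R1 by simp
  qed
  have "cylinder_solution (\<lambda>t p. u (?q t p)) (polar_t b u) (polar_p b u) ?wtt ?wtp ?wpp
    (\<lambda>t p. K (?q t p)) (polar_t b K) (max 0 C) c1 c2 \<gamma> \<theta> (max 0 (ln R1)) ?M B"
  proof
    fix t p :: real
    show "((\<lambda>t. u (?q t p)) has_real_derivative polar_t b u t p) (at t)"
      "((\<lambda>p. u (?q t p)) has_real_derivative polar_p b u t p) (at p)"
      "((\<lambda>t. K (?q t p)) has_real_derivative polar_t b K t p) (at t)"
      by (intro polar_deriv u K)+
    show "((\<lambda>p. polar_t b u t p) has_real_derivative ?wtp t p) (at p)" by (rule wt_p)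
    show "((\<lambda>t. polar_p b u t p) has_real_derivative ?wtp t p) (at t)" unfolding mixed by (rule wp_t)
    show "((\<lambda>t. polar_t b u t p) has_real_derivative ?wtt t p) (at t)"
      unfolding polar_t_def[of b u]
      by (rule derivative_eq_intros polar_deriv Cu refl)+ (simp add: algebra_simps)
    show "((\<lambda>p. polar_p b u t p) has_real_derivative ?wpp t p) (at p)"
      unfolding polar_p_def[of b u]
      by (rule derivative_eq_intros polar_deriv Cu refl)+ (simp add: algebra_simps)
    show "u (?q t (2*pi)) = u (?q t 0)" "polar_t b u t (2*pi) = polar_t b u t 0"
      "polar_p b u t (2*pi) = polar_p b u t 0"
      by (simp_all add: polar_pt_periodic polar_t_def polar_p_def)
    show "?wtt t p + ?wpp t p = - (K (?q t p) * exp (2*t + 2 * u (?q t p)))"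
    proof -
      \<comment> \<open>The first-order terms of \<open>?wtt\<close> and \<open>?wpp\<close> cancel,
        and so do the mixed second derivatives, term by term.\<close>
      have "?wtt t p + ?wpp t p = exp t * exp t * (((cos (b + p))\<^sup>2 + (sin (b + p))\<^sup>2) * laplacian u (?q t p))"
        unfolding polar_t_def polar_p_def laplacian_pd
        unfolding power2_eq_square by (simp only: algebra_simps)
      also have "\<dots> = exp t * exp t * laplacian u (?q t p)" by simp
      also have "laplacian u (?q t p) = - (K (?q t p) * exp (2 * u (?q t p)))"
        using eq[of "?q t p"] by linarith
      also have "exp t * exp t * \<dots> = - (K (?q t p) * exp (2*t + 2 * u (?q t p)))"
        by (simp add: exp_add exp_double power2_eq_square)
      finally show ?thesis .
    qed
    show "polar_t b K t p \<le> 0"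
      using K_radial[of "?q t p"] unfolding inner_gradient polar_pt_nth polar_t_def
      by (simp add: algebra_simps)
    show "u (?q t p) \<le> max 0 C" using C by (simp add: le_max_iff_disj)
    show "\<bar>K (?q t p)\<bar> \<le> c2 * exp (\<gamma> * t)" if "max 0 (ln R1) \<le> t"
      using upper[of "?q t p"] ge[OF that] by (simp add: norm_polar_pt powr)
    show "c1 * exp (\<gamma> * t) \<le> \<bar>K (?q t p)\<bar>" if "max 0 (ln R1) \<le> t" "0 \<le> p" "p \<le> \<theta>"
    proof -
      \<comment> \<open>The angle to the axis is \<open>p\<close>, and cosine decreases on [0, pi],
        so the angles from 0 to \<theta> lie in the cone; this half of it suffices.\<close>
      have "?q t p \<bullet> ?q 0 0 = exp t * cos (b + p - b)"
        unfolding cos_diff by (simp add: inner_vec_def sum_2 polar_pt_nth algebra_simps)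
      moreover have "cos \<theta> \<le> cos p" using that \<theta> by (intro cos_monotone_0_pi_le) auto
      ultimately have "?q t p \<in> circular_cone (?q 0 0) \<theta> - ball 0 R1"
        using ge[OF that(1)] by (simp add: circular_cone_def norm_polar_pt)
      from lower[OF this] show ?thesis by (simp add: norm_polar_pt powr)
    qed
    show "integral {0..t} (\<lambda>t. circle_int (\<lambda>p. \<bar>K (?q t p) * exp (2*t + 2 * u (?q t p))\<bar>)) \<le> ?M" if "0 \<le> t"
    proof -
      have "continuous_on UNIV (\<lambda>x. \<bar>K x\<bar> * exp (2 * u x))"
        by (intro continuous_intros C_infinity_continuous u K)
      from polar_mass[OF this _ integrable_on_lborel[OF int] that, of b]
      show ?thesis by (simp add: abs_mult exp_add mult_ac)
    qed
    show "\<bar>polar_t b u t p\<bar> \<le> B * exp t" "\<bar>polar_p b u t p\<bar> \<le> B * exp t" if "t \<le> 0"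
      by (rule order_trans[OF polar_abs_le(1)], rule mult_right_mono[OF B'(2)[OF that]], simp)
        (rule order_trans[OF polar_abs_le(2)], rule mult_right_mono[OF B'(2)[OF that]], simp)
    show "\<bar>K (?q t p)\<bar> \<le> B" if "t \<le> 0" by (rule B'(3)[OF that])
    show "0 \<le> B" using B'(1)[of 0] by simp
  qed ((intro continuous_intros jc)+, use \<theta> \<gamma> c12 in auto)
  then show False by (rule cylinder_solution.no_solution)
qed

theorem theorem1p3:
  fixes K :: "real^2 \<Rightarrow> real"
  assumes "C_infinity K"
    and "PCC K"
    and "\<And>x. x \<bullet> gradient K x \<le> 0"
  shows "\<not> (\<exists>u :: real^2 \<Rightarrow> real.
           C_infinity u \<and>
           (\<forall>x. - laplacian u x = K x * exp (2 * u x)) \<and>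
           (\<exists>C. \<forall>x. u x \<le> C) \<and>
           integrable lborel (\<lambda>x. \<bar>K x\<bar> * exp (2 * u x)))"
proof (intro notI, elim exE conjE)
  fix u :: "real^2 \<Rightarrow> real" and C
  assume u: "C_infinity u" "\<forall>x. - laplacian u x = K x * exp (2 * u x)" "\<forall>x. u x \<le> C"
    "integrable lborel (\<lambda>x. \<bar>K x\<bar> * exp (2 * u x))"
  obtain R1 \<theta> \<gamma> c1 c2 :: real and e :: "real^2" where
    "R1 > 0 \<and> 0 < \<theta> \<and> \<theta> \<le> pi \<and> \<gamma> \<ge> real DIM(real^2) \<and> c1 > 0 \<and> c2 > 0 \<and> norm e = 1 \<and>
      (\<forall>x. norm x \<ge> R1 \<longrightarrow> \<bar>K x\<bar> \<le> c2 * norm x powr \<gamma>) \<and>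
      (\<forall>x \<in> circular_cone e \<theta> - ball 0 R1. \<bar>K x\<bar> \<ge> c1 * norm x powr \<gamma>)"
    using assms(2) unfolding PCC_def by (elim conjE exE) (rule that, intro conjI)
  then have P: "R1 > 0" "0 < \<theta>" "\<theta> \<le> pi" "\<gamma> \<ge> real DIM(real^2)" "c1 > 0" "c2 > 0" "norm e = 1"
      "\<And>x. norm x \<ge> R1 \<Longrightarrow> \<bar>K x\<bar> \<le> c2 * norm x powr \<gamma>"
      "\<And>x. x \<in> circular_cone e \<theta> - ball 0 R1 \<Longrightarrow> \<bar>K x\<bar> \<ge> c1 * norm x powr \<gamma>"
    by simp_all
  have "(e$1)\<^sup>2 + (e$2)\<^sup>2 = 1"
    using P(7) unfolding norm_eq_1 by (simp add: inner_vec_def sum_2 power2_eq_square)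
  then obtain b where b: "e$1 = cos b" "e$2 = sin b"
    using sincos_total_2pi_le by blast
  have "e = polar_pt b 0 0" by (simp add: vec_eq_iff forall_2 polar_pt_nth b)
  with P show False
    by (intro cylinder_solution_polar[OF assms(1) u(1) assms(3) _ _ u(4) P(1-3) _ P(5,6,8), of C b])
      (use u in auto)
qed

end
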